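(* Let $K$ be a field, $S=K[x_1,\ldots,x_n]$, and let $I\subset S$ be an ideal of Borel type. The following conditions are equivalent: (a) $I$ is of strong intersection type; (b) $I$ is of intersection type; (c) $I$ is principal Borel.
   Context: An ideal of Borel type is a monomial ideal $I\subset S$ such that $I:x_j^\infty=I:(x_1,\ldots,x_j)^\infty$ for all $j=1,\ldots,n$, where $I:J^\infty=\bigcup_k(I:J^k)$. A Borel (strongly stable) ideal is a monomial ideal $I$ such that for every monomial $u\in I$, every $j$ with $x_j\mid u$ and every $i<j$ one has $x_i(u/x_j)\in I$. The principal Borel ideal generated by a monomial $u$ is the smallest Borel ideal containing $u$; an ideal is principal Borel if it is of this form for some monomial $u$. A monomial prime ideal is a prime ideal generated by a subset of the variables. A monomial ideal $I$ is of intersection type if it is an intersection of powers of monomial prime ideals. An irredundant such presentation has the form $I=\bigcap_{\mathfrak p\in\operatorname{Ass}(S/I)}\mathfrak p^{d_{\mathfrak p}}$ and is called the canonical primary decomposition of $I$. The ideal $I$ is of strong intersection type if it is of intersection type and, in this presentation, $d_{\mathfrak p}=\operatorname{reg}(I(\mathfrak p))$ for all $\mathfrak p\in\operatorname{Ass}(S/I)$. Here $\operatorname{reg}$ is Castelnuovo–Mumford regularity and $I(\mathfrak p)$ is the monomial localization: the image of $I$ under the $K$-algebra homomorphism $S\to S(\mathfrak p)$, where $S(\mathfrak p)$ is the polynomial ring over $K$ in the variables belonging to $\mathfrak p$, with $x_i\mapsto x_i$ if $x_i\in\mathfrak p$ and $x_i\mapsto1$ otherwise.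
   Formalization: The ideal I is assumed nonzero: the zero ideal is of Borel type and of intersection type (it is the first power of the monomial prime (0) generated by no variables), but it contains no monomial and so is not principal Borel. *)

theory Defs
  imports "HOL-Library.Poly_Mapping" "HOL-Algebra.Ideal_Product"
begin

section \<open>Polynomial rings in a set of variables\<close>

text \<open>
  A monomial is represented by its exponent vector of type \<^typ>\<open>nat \<Rightarrow>\<^sub>0 nat\<close>.  The variables
  \<open>x\<^sub>1, \<dots>, x\<^sub>n\<close> carry the indices \<open>1, \<dots>, n\<close>, so that \<open>K[x\<^sub>1, \<dots>, x\<^sub>n]\<close> is \<open>mpoly_ring {1..n}\<close>.
\<close>

type_synonym 'k mpoly = "(nat \<Rightarrow>\<^sub>0 nat) \<Rightarrow>\<^sub>0 'k"

definition mpoly_ring :: "nat set \<Rightarrow> 'k::field mpoly ring" where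
  "mpoly_ring V =
     \<lparr>carrier = {f. \<forall>m \<in> Poly_Mapping.keys f. Poly_Mapping.keys m \<subseteq> V},
      monoid.mult = (*), one = 1, zero = 0, add = (+)\<rparr>"

definition monomial :: "(nat \<Rightarrow>\<^sub>0 nat) \<Rightarrow> 'k::field mpoly" where
  "monomial m = Poly_Mapping.single m 1"

definition X :: "nat \<Rightarrow> 'k::field mpoly" where
  "X i = monomial (Poly_Mapping.single i 1)"

definition mdeg :: "(nat \<Rightarrow>\<^sub>0 nat) \<Rightarrow> nat" where
  "mdeg m = (\<Sum>i \<in> Poly_Mapping.keys m. Poly_Mapping.lookup m i)"

text \<open>For negative \<open>e\<close> only the zero polynomial is homogeneous of degree \<open>e\<close>.\<close>

definition homogeneous :: "int \<Rightarrow> 'k::field mpoly \<Rightarrow> bool" where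
  "homogeneous e f \<longleftrightarrow> (\<forall>m \<in> Poly_Mapping.keys f. int (mdeg m) = e)"

lemma mpoly_ring_cring: "cring (mpoly_ring V :: 'k::field mpoly ring)"
proof (rule cringI)
  show "abelian_group (mpoly_ring V :: 'k mpoly ring)"
  proof (rule abelian_groupI)
    fix f :: "'k mpoly"
    assume "f \<in> carrier (mpoly_ring V)"
    then show "\<exists>g \<in> carrier (mpoly_ring V). g \<oplus>\<^bsub>mpoly_ring V\<^esub> f = \<zero>\<^bsub>mpoly_ring V\<^esub>"
      by (intro bexI[of _ "- f"]) (auto simp: mpoly_ring_def)
  qed (use Poly_Mapping.keys_add in \<open>fastforce simp: mpoly_ring_def algebra_simps\<close>)+
  show "comm_monoid (mpoly_ring V :: 'k mpoly ring)"
  proof (rule comm_monoidI)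
    fix f g :: "'k mpoly"
    assume fg: "f \<in> carrier (mpoly_ring V)" "g \<in> carrier (mpoly_ring V)"
    have "Poly_Mapping.keys m \<subseteq> V" if "m \<in> Poly_Mapping.keys (f * g)" for m
    proof -
      have "m \<in> {a + b |a b. a \<in> Poly_Mapping.keys f \<and> b \<in> Poly_Mapping.keys g}"
        using that by (rule subsetD[OF keys_mult])
      then obtain a b where "m = a + b" "a \<in> Poly_Mapping.keys f" "b \<in> Poly_Mapping.keys g"
        by blast
      then show ?thesis
        using fg Poly_Mapping.keys_add[of a b] by (fastforce simp: mpoly_ring_def)
    qed
    then show "f \<otimes>\<^bsub>mpoly_ring V\<^esub> g \<in> carrier (mpoly_ring V)"
      by (simp add: mpoly_ring_def)
  qed (auto simp: mpoly_ring_def algebra_simps)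
qed (simp add: mpoly_ring_def algebra_simps)


section \<open>Ideals\<close>

definition ideal_power :: "nat set \<Rightarrow> 'k::field mpoly set \<Rightarrow> nat \<Rightarrow> 'k mpoly set" where
  "ideal_power V J d = J [^]\<^bsub>ideals_set (mpoly_ring V)\<^esub> d"

definition ideal_quotient :: "nat set \<Rightarrow> 'k::field mpoly set \<Rightarrow> 'k mpoly set \<Rightarrow> 'k mpoly set" where
  "ideal_quotient V I J = {f \<in> carrier (mpoly_ring V). \<forall>g \<in> J. f * g \<in> I}"

definition saturation :: "nat set \<Rightarrow> 'k::field mpoly set \<Rightarrow> 'k mpoly set \<Rightarrow> 'k mpoly set" where
  "saturation V I J = (\<Union>k::nat. ideal_quotient V I (ideal_power V J k))"

definition var_ideal :: "nat set \<Rightarrow> nat set \<Rightarrow> 'k::field mpoly set" where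
  "var_ideal V A = Idl\<^bsub>mpoly_ring V\<^esub> (X ` A)"

definition monomial_ideal :: "nat set \<Rightarrow> 'k::field mpoly set \<Rightarrow> bool" where
  "monomial_ideal V I \<longleftrightarrow>
     (\<exists>M. (\<forall>m \<in> M. Poly_Mapping.keys m \<subseteq> V) \<and> I = Idl\<^bsub>mpoly_ring V\<^esub> (monomial ` M))"

definition monomial_prime :: "nat set \<Rightarrow> 'k::field mpoly set \<Rightarrow> bool" where
  "monomial_prime V P \<longleftrightarrow> primeideal P (mpoly_ring V) \<and> (\<exists>A \<subseteq> V. P = var_ideal V A)"

text \<open>The associated primes of \<open>S/I\<close>: the primes that are annihilators of a residue class \<open>f + I\<close>.\<close>

definition ass_primes :: "nat set \<Rightarrow> 'k::field mpoly set \<Rightarrow> 'k mpoly set set" where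
  "ass_primes V I =
     {P. primeideal P (mpoly_ring V) \<and>
         (\<exists>f \<in> carrier (mpoly_ring V). P = {g \<in> carrier (mpoly_ring V). g * f \<in> I})}"


section \<open>Ideals of Borel type and principal Borel ideals\<close>

definition borel_type :: "nat \<Rightarrow> 'k::field mpoly set \<Rightarrow> bool" where
  "borel_type n I \<longleftrightarrow>
     monomial_ideal {1..n} I \<and>
     (\<forall>j \<in> {1..n}. saturation {1..n} I (var_ideal {1..n} {j}) =
                    saturation {1..n} I (var_ideal {1..n} {1..j}))"

definition borel_ideal :: "nat \<Rightarrow> 'k::field mpoly set \<Rightarrow> bool" where
  "borel_ideal n I \<longleftrightarrow>
     monomial_ideal {1..n} I \<and>
     (\<forall>u. monomial u \<in> I \<longrightarrow>
        (\<forall>j \<in> Poly_Mapping.keys u. \<forall>i \<in> {1..<j}.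
           monomial (Poly_Mapping.single i 1 + (u - Poly_Mapping.single j 1)) \<in> I))"

definition principal_borel :: "nat \<Rightarrow> 'k::field mpoly set \<Rightarrow> bool" where
  "principal_borel n I \<longleftrightarrow>
     (\<exists>u. Poly_Mapping.keys u \<subseteq> {1..n} \<and> borel_ideal n I \<and> monomial u \<in> I \<and>
          (\<forall>J. borel_ideal n J \<and> monomial u \<in> J \<longrightarrow> I \<subseteq> J))"


section \<open>Castelnuovo--Mumford regularity\<close>

text \<open>
  The free module of rank \<open>r\<close> over \<open>mpoly_ring V\<close>; vectors are functions vanishing from index \<open>r\<close> on.
\<close>

definition free_mod :: "nat set \<Rightarrow> nat \<Rightarrow> (nat \<Rightarrow> 'k::field mpoly) set" where
  "free_mod V r = {v. (\<forall>k<r. v k \<in> carrier (mpoly_ring V)) \<and> (\<forall>k\<ge>r. v k = 0)}"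

definition mat_apply ::
  "nat \<Rightarrow> nat \<Rightarrow> (nat \<Rightarrow> nat \<Rightarrow> 'k::field mpoly) \<Rightarrow> (nat \<Rightarrow> 'k mpoly) \<Rightarrow> nat \<Rightarrow> 'k mpoly" where
  "mat_apply r c A v = (\<lambda>l. if l < r then (\<Sum>k<c. A l k * v k) else 0)"

text \<open>
  A minimal graded free resolution
  \<open>\<dots> \<rightarrow> F\<^sub>2 \<rightarrow> F\<^sub>1 \<rightarrow> F\<^sub>0 \<rightarrow> I \<rightarrow> 0\<close> of the ideal \<open>I\<close> as a graded module over \<open>mpoly_ring V\<close>, where
  \<open>F\<^sub>i\<close> is the direct sum of the \<open>S(- sh i k)\<close> for \<open>k < b i\<close>, the augmentation sends the basis of
  \<open>F\<^sub>0\<close> to \<open>\<epsilon>\<close>, and \<open>D i\<close> is the matrix of \<open>F\<^sub>i\<^sub>+\<^sub>1 \<rightarrow> F\<^sub>i\<close>.  All maps are homogeneous of degree 0.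
  Minimality is the last clause: the entries of all \<open>D i\<close> lie in the ideal generated by the variables.
  Infinitely many nonzero \<open>F\<^sub>i\<close> are not excluded by the definition, but by Hilbert's syzygy theorem.
\<close>

definition minimal_graded_free_resolution ::
  "nat set \<Rightarrow> 'k::field mpoly set \<Rightarrow> (nat \<Rightarrow> nat) \<Rightarrow> (nat \<Rightarrow> nat \<Rightarrow> int) \<Rightarrow>
   (nat \<Rightarrow> 'k mpoly) \<Rightarrow> (nat \<Rightarrow> nat \<Rightarrow> nat \<Rightarrow> 'k mpoly) \<Rightarrow> bool" where
  "minimal_graded_free_resolution V I b sh \<epsilon> D \<longleftrightarrow>
     (\<forall>k < b 0. \<epsilon> k \<in> carrier (mpoly_ring V) \<and> homogeneous (sh 0 k) (\<epsilon> k)) \<and>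
     (\<forall>i. \<forall>l < b i. \<forall>k < b (Suc i).
        D i l k \<in> carrier (mpoly_ring V) \<and> homogeneous (sh (Suc i) k - sh i l) (D i l k)) \<and>
     {\<Sum>k<b 0. \<epsilon> k * v k |v. v \<in> free_mod V (b 0)} = I \<and>
     {v \<in> free_mod V (b 0). (\<Sum>k<b 0. \<epsilon> k * v k) = 0} =
        mat_apply (b 0) (b 1) (D 0) ` free_mod V (b 1) \<and>
     (\<forall>i. {v \<in> free_mod V (b (Suc i)). mat_apply (b i) (b (Suc i)) (D i) v = (\<lambda>_. 0)} =
        mat_apply (b (Suc i)) (b (Suc (Suc i))) (D (Suc i)) ` free_mod V (b (Suc (Suc i)))) \<and>
     (\<forall>i. \<forall>l < b i. \<forall>k < b (Suc i). D i l k \<in> var_ideal V V)"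

text \<open>
  \<open>has_regularity V I r\<close> says \<open>reg I = r\<close>, that is, \<open>r\<close> is the maximum of all \<open>j - i\<close> such that \<open>S(-j)\<close>
  occurs in \<open>F\<^sub>i\<close>.  It does not matter which minimal graded free resolution is used, since these are
  unique up to isomorphism.  No integer is the regularity of the zero ideal.
\<close>

definition has_regularity :: "nat set \<Rightarrow> 'k::field mpoly set \<Rightarrow> int \<Rightarrow> bool" where
  "has_regularity V I r \<longleftrightarrow>
     (\<exists>b sh \<epsilon> D. minimal_graded_free_resolution V I b sh \<epsilon> D \<and>
        (\<exists>i. \<exists>k < b i. sh i k - int i = r) \<and>
        (\<forall>i. \<forall>k < b i. sh i k - int i \<le> r))"


section \<open>Monomial localization\<close>

definition loc_vars :: "nat set \<Rightarrow> 'k::field mpoly set \<Rightarrow> nat set" where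
  "loc_vars V P = {i \<in> V. X i \<in> P}"

definition localization_hom :: "'k::field mpoly set \<Rightarrow> 'k mpoly \<Rightarrow> 'k mpoly" where
  "localization_hom P f =
     (\<Sum>m \<in> Poly_Mapping.keys f. Poly_Mapping.single 0 (Poly_Mapping.lookup f m) *
        (\<Prod>i \<in> Poly_Mapping.keys m. (if X i \<in> P then X i else 1) ^ Poly_Mapping.lookup m i))"

definition monomial_localization :: "'k::field mpoly set \<Rightarrow> 'k mpoly set \<Rightarrow> 'k mpoly set" where
  "monomial_localization P I = localization_hom P ` I"


section \<open>Ideals of intersection type\<close>

text \<open>
  Intersections are taken inside the ring, so that the empty one is the unit ideal.
\<close>

definition intersection_type :: "nat set \<Rightarrow> 'k::field mpoly set \<Rightarrow> bool" where
  "intersection_type V I \<longleftrightarrow>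
     monomial_ideal V I \<and>
     (\<exists>F :: ('k mpoly set \<times> nat) set. finite F \<and> (\<forall>(P, d) \<in> F. monomial_prime V P) \<and>
        I = carrier (mpoly_ring V) \<inter> (\<Inter>(P, d) \<in> F. ideal_power V P d))"

definition canonical_primary_decomposition ::
  "nat set \<Rightarrow> 'k::field mpoly set \<Rightarrow> ('k mpoly set \<Rightarrow> nat) \<Rightarrow> bool" where
  "canonical_primary_decomposition V I d \<longleftrightarrow>
     (\<forall>P \<in> ass_primes V I. monomial_prime V P) \<and>
     I = carrier (mpoly_ring V) \<inter> (\<Inter>P \<in> ass_primes V I. ideal_power V P (d P)) \<and>
     (\<forall>Q \<in> ass_primes V I.
        I \<noteq> carrier (mpoly_ring V) \<inter> (\<Inter>P \<in> ass_primes V I - {Q}. ideal_power V P (d P)))"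

definition strong_intersection_type :: "nat set \<Rightarrow> 'k::field mpoly set \<Rightarrow> bool" where
  "strong_intersection_type V I \<longleftrightarrow>
     intersection_type V I \<and>
     (\<exists>d. canonical_primary_decomposition V I d \<and>
        (\<forall>P \<in> ass_primes V I.
           has_regularity (loc_vars V P) (monomial_localization P I) (int (d P))))"

end

theory Submission
  imports Defs
begin

text \<open>
  Everything is governed by the partial degrees \<open>m\<^sub>1 + \<dots> + m\<^sub>j\<close> of an exponent vector \<open>m\<close>, written
  \<open>vdeg {1..j} m\<close>.  The principal Borel ideal of \<open>u\<close> consists of the polynomials all of whose monomials
  dominate \<open>u\<close>, that is, have every partial degree at least as large as that of \<open>u\<close>
  (\<open>principal_borel_iff\<close>).  In other words, it is the intersection of the powers
  \<open>(x\<^sub>1, \<dots>, x\<^sub>j)\<^sup>d\<close> with \<open>d = vdeg {1..j} u\<close>, so it is of intersection type.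

  Conversely, a monomial lies in an intersection of powers \<open>P\<^sub>A\<^sup>d\<close> of monomial primes if and only if
  \<open>vdeg A m \<ge> d\<close> for all pairs \<open>(A, d)\<close>.  Saturating at \<open>x\<^sub>i\<close> drops the conditions with \<open>i \<in> A\<close>, and
  saturating at \<open>(x\<^sub>1, \<dots>, x\<^sub>i)\<close> drops only those with \<open>{1..i} \<subseteq> A\<close>.  If both saturations agree, then a
  condition with \<open>{1..p} \<subseteq> A\<close> and \<open>p + 1 \<notin> A\<close> survives when the variables \<open>x\<^sub>n, x\<^sub>n\<^sub>-\<^sub>1, \<dots>, x\<^sub>p\<^sub>+\<^sub>1\<close> are
  stripped from \<open>m\<close> one after the other; it thus already reads \<open>vdeg {1..p} m \<ge> d\<close>
  (\<open>borel_type_prefix\<close>).  Conditions on initial segments alone define the dominance set of a suitable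
  \<open>u\<close> (\<open>prefix_conditions_dominating\<close>).

  For the strong form, the associated primes of the ideal of \<open>u\<close> are the \<open>(x\<^sub>1, \<dots>, x\<^sub>i)\<close> with
  \<open>x\<^sub>i\<close> dividing \<open>u\<close>, the localization at such a prime is the principal Borel ideal of the part of \<open>u\<close> in
  the first \<open>i\<close> variables, and its regularity has to be the degree \<open>vdeg {1..i} u\<close> of its generators.  So
  a linear minimal free resolution must be exhibited.  This is done with bases in the style of Pommaret:
  each generator has a class \<open>c\<close> such that every element is a unique combination of generators in
  which a generator of class \<open>c\<close> gets a coefficient from \<open>K[x\<^sub>c, \<dots>, x\<^sub>N]\<close>.  The minimal generators of a
  principal Borel ideal form such a basis if the class of a monomial is its largest variable
  (\<open>borel_gens_involutive\<close>), and the syzygies of such a basis again have such a basis, with linear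
  entries (\<open>syzygies_have_involutive_basis\<close>).  Iteration yields the resolution.
\<close>


section \<open>Monomial ideals as sets of exponent vectors\<close>

abbreviation polys :: "nat set \<Rightarrow> 'k::field mpoly set" where
  "polys V \<equiv> carrier (mpoly_ring V)"

definition mons :: "nat set \<Rightarrow> (nat \<Rightarrow>\<^sub>0 nat) set" where
  "mons V = {m. Poly_Mapping.keys m \<subseteq> V}"

definition mon_span :: "(nat \<Rightarrow>\<^sub>0 nat) set \<Rightarrow> 'k::field mpoly set" where
  "mon_span E = {f. Poly_Mapping.keys f \<subseteq> E}"

text \<open>
  The exponent sets whose span is an ideal, necessarily a monomial one, of \<open>mpoly_ring V\<close>.
\<close>

definition upset :: "nat set \<Rightarrow> (nat \<Rightarrow>\<^sub>0 nat) set \<Rightarrow> bool" where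
  "upset V E \<longleftrightarrow> E \<subseteq> mons V \<and> (\<forall>m \<in> E. \<forall>w \<in> mons V. m + w \<in> E)"

lemma polys_eq_mon_span: "polys V = mon_span (mons V)"
  by (auto simp: mpoly_ring_def mon_span_def mons_def)

lemma polys_iff: "f \<in> polys V \<longleftrightarrow> Poly_Mapping.keys f \<subseteq> mons V"
  by (simp add: polys_eq_mon_span mon_span_def)

lemma mpoly_ring_simps [simp]:
  "x \<otimes>\<^bsub>mpoly_ring V\<^esub> y = x * y" "x \<oplus>\<^bsub>mpoly_ring V\<^esub> y = x + y"
  "\<one>\<^bsub>mpoly_ring V\<^esub> = 1" "\<zero>\<^bsub>mpoly_ring V\<^esub> = 0"
  by (simp_all add: mpoly_ring_def)

lemma keys_plus_nat:
  fixes m w :: "nat \<Rightarrow>\<^sub>0 nat"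
  shows "Poly_Mapping.keys (m + w) = Poly_Mapping.keys m \<union> Poly_Mapping.keys w"
  by (auto simp: in_keys_iff lookup_add)

lemma mons_add_iff [simp]: "m + w \<in> mons V \<longleftrightarrow> m \<in> mons V \<and> w \<in> mons V"
  by (simp add: mons_def keys_plus_nat)

lemma mons_zero [simp]: "0 \<in> mons V"
  by (simp add: mons_def)

lemma mons_single [simp]: "i \<in> V \<Longrightarrow> Poly_Mapping.single i a \<in> mons V"
  by (simp add: mons_def)

lemma mons_mono: "V \<subseteq> W \<Longrightarrow> mons V \<subseteq> mons W"
  by (auto simp: mons_def)

lemma mons_diff: "m \<in> mons V \<Longrightarrow> m - w \<in> mons V"
  by (auto simp: mons_def in_keys_iff lookup_minus subset_iff)

lemma mons_lookup_zero: "m \<in> mons V \<Longrightarrow> i \<notin> V \<Longrightarrow> Poly_Mapping.lookup m i = 0"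
  by (auto simp: mons_def in_keys_iff subset_iff)

lemma single_plus_diff:
  fixes m :: "nat \<Rightarrow>\<^sub>0 nat"
  assumes "a \<le> Poly_Mapping.lookup m i"
  shows "Poly_Mapping.single i a + (m - Poly_Mapping.single i a) = m"
  using assms by (intro poly_mapping_eqI) (auto simp: lookup_add lookup_minus lookup_single when_def)

lemma mons_eqI:
  assumes "m \<in> mons V" "w \<in> mons V"
    and "\<And>i. i \<in> V \<Longrightarrow> Poly_Mapping.lookup m i = Poly_Mapping.lookup w i"
  shows "m = w"
  by (rule poly_mapping_eqI) (metis assms mons_lookup_zero)

lemma mon_span_zero [simp]: "0 \<in> mon_span E"
  by (simp add: mon_span_def)

lemma mon_span_add: "f \<in> mon_span E \<Longrightarrow> g \<in> mon_span E \<Longrightarrow> f + g \<in> mon_span E"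
  using Poly_Mapping.keys_add[of f g] by (auto simp: mon_span_def)

lemma mon_span_uminus: "f \<in> mon_span E \<Longrightarrow> - f \<in> mon_span E"
  by (simp add: mon_span_def)

lemma mon_span_diff: "f \<in> mon_span E \<Longrightarrow> g \<in> mon_span E \<Longrightarrow> f - g \<in> mon_span E"
  using mon_span_add[of f E "- g"] by (simp add: mon_span_uminus)

lemma mon_span_sum: "(\<And>i. i \<in> A \<Longrightarrow> f i \<in> mon_span E) \<Longrightarrow> sum f A \<in> mon_span E"
  by (induction A rule: infinite_finite_induct) (auto intro: mon_span_add)

lemma mon_span_mult:
  assumes "f \<in> mon_span E" "g \<in> mon_span F" and "\<And>a b. a \<in> E \<Longrightarrow> b \<in> F \<Longrightarrow> a + b \<in> G"
  shows "f * g \<in> mon_span G"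
  using keys_mult[of f g] assms unfolding mon_span_def by blast

lemma mon_span_mono: "E \<subseteq> F \<Longrightarrow> mon_span E \<subseteq> mon_span F"
  by (auto simp: mon_span_def)

lemma single_in_mon_span: "Poly_Mapping.single m c \<in> mon_span E \<longleftrightarrow> c = 0 \<or> m \<in> E"
  by (simp add: mon_span_def)

lemma monomial_in_mon_span [simp]: "monomial m \<in> mon_span E \<longleftrightarrow> m \<in> E"
  by (simp add: monomial_def single_in_mon_span)

lemma mon_span_inject [simp]: "(mon_span E :: 'k::field mpoly set) = mon_span F \<longleftrightarrow> E = F"
proof
  assume "(mon_span E :: 'k mpoly set) = mon_span F"
  then have "(monomial m :: 'k mpoly) \<in> mon_span E \<longleftrightarrow> (monomial m :: 'k mpoly) \<in> mon_span F" for m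
    by simp
  then show "E = F" by auto
qed simp

text \<open>
  Membership in an ideal is mostly verified term by term along this expansion.
\<close>

lemma mpoly_expand:
  "f = (\<Sum>m \<in> Poly_Mapping.keys f. Poly_Mapping.single m (Poly_Mapping.lookup f m))"
  by (rule poly_mapping_eqI)
     (auto simp: lookup_sum lookup_single when_def in_keys_iff sum.delta')

lemma monomial_add: "monomial (m + w) = monomial m * monomial w"
  by (simp add: monomial_def mult_single)

lemma polys_monomial [simp]: "monomial m \<in> polys V \<longleftrightarrow> m \<in> mons V"
  by (simp add: polys_eq_mon_span)

lemma ideal_mon_span:
  assumes "upset V E"
  shows "ideal (mon_span E :: 'k::field mpoly set) (mpoly_ring V)"
proof -
  interpret R: cring "mpoly_ring V :: 'k mpoly ring" by (rule mpoly_ring_cring)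
  have sub: "(mon_span E :: 'k mpoly set) \<subseteq> polys V"
    using assms by (auto simp: polys_eq_mon_span upset_def mon_span_def)
  have neg: "\<ominus>\<^bsub>mpoly_ring V\<^esub> f = - f" if "f \<in> polys V" for f :: "'k mpoly"
  proof (rule R.minus_equality)
    show "- f \<oplus>\<^bsub>mpoly_ring V\<^esub> f = \<zero>\<^bsub>mpoly_ring V\<^esub>" by simp
  qed (use that in \<open>simp_all add: polys_eq_mon_span mon_span_uminus\<close>)
  have mult: "f * g \<in> mon_span E" if "f \<in> mon_span E" "g \<in> polys V" for f g :: "'k mpoly"
    using that assms by (auto simp: polys_eq_mon_span upset_def intro: mon_span_mult)
  show ?thesis
  proof (rule idealI)
    show "ring (mpoly_ring V :: 'k mpoly ring)" by (rule R.ring_axioms)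
    show "subgroup (mon_span E) (add_monoid (mpoly_ring V :: 'k mpoly ring))"
    proof (rule R.add.subgroupI)
      show "(mon_span E :: 'k mpoly set) \<noteq> {}" using mon_span_zero by blast
      show "\<ominus>\<^bsub>mpoly_ring V\<^esub> f \<in> mon_span E" if "f \<in> mon_span E" for f :: "'k mpoly"
        using that sub by (simp add: neg subset_iff mon_span_uminus)
    qed (use sub in \<open>auto intro: mon_span_add\<close>)
  qed (use mult in \<open>auto simp: mult.commute\<close>)
qed

lemma ideal_sum_closed:
  assumes "ideal J (mpoly_ring V :: 'k::field mpoly ring)" "\<And>i. i \<in> A \<Longrightarrow> g i \<in> J"
  shows "sum g A \<in> J"
proof -
  have "0 \<in> J"
    using additive_subgroup.zero_closed[OF ideal.axioms(1)[OF assms(1)]] by simp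
  moreover have "x + y \<in> J" if "x \<in> J" "y \<in> J" for x y
    using additive_subgroup.a_closed[OF ideal.axioms(1)[OF assms(1)] that] by simp
  ultimately show ?thesis
    using assms(2) by (induction A rule: infinite_finite_induct) auto
qed

text \<open>
  The dictionary between monomial ideals and exponent sets: a polynomial lies in the ideal as soon as
  each of its terms does, and a term lies in it if it is a multiple of a generating monomial.
\<close>

lemma Idl_monomials:
  assumes "M \<subseteq> mons V"
  shows "Idl\<^bsub>mpoly_ring V\<^esub> (monomial ` M :: 'k::field mpoly set) =
           mon_span {u + w |u w. u \<in> M \<and> w \<in> mons V}" (is "_ = mon_span ?E")
proof -
  interpret R: cring "mpoly_ring V :: 'k mpoly ring" by (rule mpoly_ring_cring)
  have up: "upset V ?E"
    using assms by (auto simp: upset_def add.assoc) (metis mons_add_iff)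
  have sub: "(monomial ` M :: 'k mpoly set) \<subseteq> polys V"
    using assms by auto
  have "\<exists>a w. u = a + w \<and> a \<in> M \<and> w \<in> mons V" if "u \<in> M" for u
    using that by (intro exI[of _ u] exI[of _ 0]) simp
  then have "(monomial ` M :: 'k mpoly set) \<subseteq> mon_span ?E"
    by auto
  then have 1: "Idl\<^bsub>mpoly_ring V\<^esub> (monomial ` M :: 'k mpoly set) \<subseteq> mon_span ?E"
    by (intro R.genideal_minimal ideal_mon_span up)
  have id: "ideal (Idl\<^bsub>mpoly_ring V\<^esub> (monomial ` M :: 'k mpoly set)) (mpoly_ring V)"
    by (rule R.genideal_ideal[OF sub])
  have "f \<in> Idl\<^bsub>mpoly_ring V\<^esub> (monomial ` M)" if f: "f \<in> mon_span ?E" for f :: "'k mpoly"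
  proof (subst mpoly_expand, rule ideal_sum_closed[OF id])
    fix m assume "m \<in> Poly_Mapping.keys f"
    then obtain u w where m: "m = u + w" and u: "u \<in> M" and w: "w \<in> mons V"
      using f by (auto simp: mon_span_def)
    let ?s = "Poly_Mapping.single w (Poly_Mapping.lookup f m)"
    have "(monomial u :: 'k mpoly) \<in> Idl\<^bsub>mpoly_ring V\<^esub> (monomial ` M)"
      using R.genideal_self[OF sub] u by auto
    moreover have "?s \<in> polys V"
      using w by (simp add: polys_eq_mon_span single_in_mon_span)
    ultimately have "monomial u \<otimes>\<^bsub>mpoly_ring V\<^esub> ?s \<in> Idl\<^bsub>mpoly_ring V\<^esub> (monomial ` M)"
      by (rule ideal.I_r_closed[OF id])
    then show "Poly_Mapping.single m (Poly_Mapping.lookup f m) \<in> Idl\<^bsub>mpoly_ring V\<^esub> (monomial ` M)"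
      by (simp add: monomial_def mult_single m)
  qed
  with 1 show ?thesis by blast
qed

lemma monomial_ideal_iff:
  fixes I :: "'k::field mpoly set"
  shows "monomial_ideal V I \<longleftrightarrow> (\<exists>E. upset V E \<and> I = mon_span E)"
proof
  assume "monomial_ideal V I"
  then obtain M where M: "M \<subseteq> mons V" and I: "I = Idl\<^bsub>mpoly_ring V\<^esub> (monomial ` M)"
    by (auto simp: monomial_ideal_def mons_def)
  have "upset V {u + w |u w. u \<in> M \<and> w \<in> mons V}"
    using M by (auto simp: upset_def add.assoc) (metis mons_add_iff)
  then show "\<exists>E. upset V E \<and> I = mon_span E"
    using Idl_monomials[OF M] I by blast
next
  assume "\<exists>E. upset V E \<and> I = mon_span E"
  then obtain E where E: "upset V E" "I = mon_span E" by blast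
  have "{u + w |u w. u \<in> E \<and> w \<in> mons V} = E"
    using E(1) by (auto simp: upset_def) (metis add.right_neutral mons_zero)
  then have "I = Idl\<^bsub>mpoly_ring V\<^esub> (monomial ` E)"
    using Idl_monomials[of E V, where 'k = 'k] E by (simp add: upset_def)
  moreover have "\<forall>m \<in> E. Poly_Mapping.keys m \<subseteq> V"
    using E(1) by (auto simp: upset_def mons_def)
  ultimately show "monomial_ideal V I"
    unfolding monomial_ideal_def by blast
qed


section \<open>Powers of monomial primes\<close>

definition vdeg :: "nat set \<Rightarrow> (nat \<Rightarrow>\<^sub>0 nat) \<Rightarrow> nat" where
  "vdeg A m = (\<Sum>i \<in> A. Poly_Mapping.lookup m i)"

lemma vdeg_add [simp]: "vdeg A (m + w) = vdeg A m + vdeg A w"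
  by (simp add: vdeg_def lookup_add sum.distrib)

lemma vdeg_zero [simp]: "vdeg A 0 = 0"
  by (simp add: vdeg_def)

lemma vdeg_empty [simp]: "vdeg {} m = 0"
  by (simp add: vdeg_def)

lemma vdeg_single: "finite A \<Longrightarrow> vdeg A (Poly_Mapping.single i a) = (if i \<in> A then a else 0)"
  by (simp add: vdeg_def lookup_single when_def)

lemma vdeg_mono: "finite B \<Longrightarrow> A \<subseteq> B \<Longrightarrow> vdeg A m \<le> vdeg B m"
  by (auto simp: vdeg_def intro: sum_mono2)

lemma vdeg_pos_iff: "finite A \<Longrightarrow> 1 \<le> vdeg A m \<longleftrightarrow> (\<exists>i \<in> A. Poly_Mapping.lookup m i \<noteq> 0)"
  using sum_eq_0_iff[of A "Poly_Mapping.lookup m"] unfolding vdeg_def by (metis less_one not_le)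

lemma mdeg_eq_vdeg:
  assumes "finite V" "m \<in> mons V" shows "mdeg m = vdeg V m"
  unfolding mdeg_def vdeg_def
  by (rule sum.mono_neutral_left) (use assms in \<open>auto simp: mons_def in_keys_iff\<close>)

lemma upset_vdeg: "upset V {m \<in> mons V. d \<le> vdeg A m}"
  by (auto simp: upset_def)

lemma var_ideal_eq:
  assumes "finite V" "A \<subseteq> V"
  shows "var_ideal V A = mon_span {m \<in> mons V. 1 \<le> vdeg A m}"
proof -
  have fin: "finite A" using assms finite_subset by blast
  let ?M = "(\<lambda>i. Poly_Mapping.single i 1) ` A :: (nat \<Rightarrow>\<^sub>0 nat) set"
  have M: "?M \<subseteq> mons V" using assms by auto
  have X: "X ` A = (monomial ` ?M :: 'a mpoly set)"
    by (auto simp: X_def)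
  have "{u + w |u w. u \<in> ?M \<and> w \<in> mons V} = {m \<in> mons V. 1 \<le> vdeg A m}" (is "?L = ?R")
  proof (intro equalityI subsetI)
    fix m assume "m \<in> ?L" then show "m \<in> ?R"
      using assms fin by (auto simp: vdeg_single)
  next
    fix m assume m: "m \<in> ?R"
    then obtain i where i: "i \<in> A" "1 \<le> Poly_Mapping.lookup m i"
      using vdeg_pos_iff[OF fin, of m] by (auto simp: Suc_le_eq)
    then have "m = Poly_Mapping.single i 1 + (m - Poly_Mapping.single i 1)"
      by (simp add: single_plus_diff)
    moreover have "m - Poly_Mapping.single i 1 \<in> mons V" using m by (simp add: mons_diff)
    ultimately show "m \<in> ?L" using i by blast
  qed
  then show ?thesis
    by (simp only: var_ideal_def X Idl_monomials[OF M])
qed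

lemma split_off_variable:
  assumes "finite A" "A \<subseteq> V" "m \<in> mons V" "Suc d \<le> vdeg A m"
  obtains u w where "m = u + w" "u \<in> mons V" "w \<in> mons V" "d \<le> vdeg A u" "1 \<le> vdeg A w"
proof -
  obtain i where i: "i \<in> A" "1 \<le> Poly_Mapping.lookup m i"
    using vdeg_pos_iff[OF assms(1), of m] assms(4) by (auto simp: Suc_le_eq)
  let ?w = "Poly_Mapping.single i 1 :: nat \<Rightarrow>\<^sub>0 nat"
  have m: "m = (m - ?w) + ?w" using i single_plus_diff[of 1 m i] by (simp add: add.commute)
  then have "vdeg A m = vdeg A (m - ?w) + 1"
    using i vdeg_add[of A "m - ?w" ?w] assms(1) by (simp add: vdeg_single)
  with m i assms show thesis
    by (intro that[of "m - ?w" ?w]) (auto simp: mons_diff vdeg_single)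
qed

text \<open>
  By induction on the exponent: a monomial of \<open>A\<close>-degree at least \<open>d + 1\<close> splits into one of
  \<open>A\<close>-degree at least \<open>d\<close> and a variable from \<open>A\<close>.
\<close>

lemma ideal_power_var_ideal:
  assumes "finite V" "A \<subseteq> V"
  shows "ideal_power V (var_ideal V A) d =
           (mon_span {m \<in> mons V. d \<le> vdeg A m} :: 'k::field mpoly set)"
proof (induction d)
  case 0
  show ?case
    by (simp add: ideal_power_def nat_pow_def ideals_set_def polys_eq_mon_span)
next
  case (Suc d)
  have fin: "finite A" using assms finite_subset by blast
  let ?R = "mpoly_ring V :: 'k mpoly ring"
  interpret R: cring ?R by (rule mpoly_ring_cring)
  let ?P = "\<lambda>d. mon_span {m \<in> mons V. d \<le> vdeg A m} :: 'k mpoly set"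
  have "ideal_power V (var_ideal V A) (Suc d) = ideal_prod ?R (?P d) (?P 1)"
    using Suc var_ideal_eq[OF assms, where 'a = 'k] by (simp add: ideal_power_def nat_pow_def ideals_set_def)
  also have "\<dots> = ?P (Suc d)"
  proof (intro equalityI subsetI)
    fix f assume "f \<in> ideal_prod ?R (?P d) (?P 1)"
    then show "f \<in> ?P (Suc d)"
      by induction (auto intro: mon_span_add elim!: mon_span_mult)
  next
    have id: "ideal (ideal_prod ?R (?P d) (?P 1)) ?R"
      by (intro R.ideal_prod_is_ideal ideal_mon_span upset_vdeg)
    fix f assume f: "f \<in> ?P (Suc d)"
    show "f \<in> ideal_prod ?R (?P d) (?P 1)"
    proof (subst mpoly_expand, rule ideal_sum_closed[OF id])
      fix m assume "m \<in> Poly_Mapping.keys f"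
      then have m: "m \<in> mons V" "Suc d \<le> vdeg A m" using f by (auto simp: mon_span_def)
      obtain u w where uw: "m = u + w" "u \<in> mons V" "w \<in> mons V" "d \<le> vdeg A u" "1 \<le> vdeg A w"
        by (rule split_off_variable[OF fin assms(2) m])
      then have "Poly_Mapping.single u (Poly_Mapping.lookup f m) \<otimes>\<^bsub>?R\<^esub> Poly_Mapping.single w 1
                   \<in> ideal_prod ?R (?P d) (?P 1)"
        by (intro ideal_prod.prod) (auto simp: single_in_mon_span)
      then show "Poly_Mapping.single m (Poly_Mapping.lookup f m) \<in> ideal_prod ?R (?P d) (?P 1)"
        by (simp add: uw(1) mult_single)
    qed
  qed
  finally show ?case .
qed

lemma monomial_in_saturation_iff:
  assumes "finite V" "A \<subseteq> V"
  shows "monomial m \<in> saturation V (mon_span E :: 'k::field mpoly set) (var_ideal V A) \<longleftrightarrow>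
           m \<in> mons V \<and> (\<exists>k. \<forall>w \<in> mons V. k \<le> vdeg A w \<longrightarrow> m + w \<in> E)"
proof -
  have "(\<forall>g \<in> mon_span {w \<in> mons V. k \<le> vdeg A w}. (monomial m :: 'k mpoly) * g \<in> mon_span E) \<longleftrightarrow>
          (\<forall>w \<in> mons V. k \<le> vdeg A w \<longrightarrow> m + w \<in> E)" (is "?L \<longleftrightarrow> ?R") for k
  proof
    assume L: ?L
    show ?R
    proof (intro ballI impI)
      fix w assume "w \<in> mons V" "k \<le> vdeg A w"
      then have "(monomial m :: 'k mpoly) * monomial w \<in> mon_span E" using L by simp
      then show "m + w \<in> E" by (simp flip: monomial_add)
    qed
  next
    assume ?R
    then show ?L by (auto intro: mon_span_mult[where E = "{m}"])
  qed
  then show ?thesis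
    by (simp add: saturation_def ideal_quotient_def ideal_power_var_ideal[OF assms])
qed

text \<open>
  The lowest \<open>A\<close>-homogeneous parts of two polynomials have a nonzero product because the ring is a
  domain, and that product is the lowest part of the full product.  This shows that the ideal of the
  variables in \<open>A\<close> is prime and that its powers are primary.
\<close>

lemma vdeg_keys_mult:
  fixes f g :: "'k::field mpoly"
  assumes "m \<in> Poly_Mapping.keys f" "vdeg A m \<le> a" "w \<in> Poly_Mapping.keys g" "vdeg A w \<le> b"
  shows "\<exists>x \<in> Poly_Mapping.keys (f * g). vdeg A x \<le> a + b"
proof -
  have split: "\<exists>a' \<le> a. \<exists>f0 f1. f = f0 + f1 \<and> f0 \<noteq> 0 \<and> f0 \<in> mon_span {m. vdeg A m = a'} \<and>
      f1 \<in> mon_span {m. a' < vdeg A m}"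
    if f: "m \<in> Poly_Mapping.keys f" "vdeg A m \<le> a" for f :: "'k mpoly" and m a
  proof -
    define a' where "a' = Min (vdeg A ` Poly_Mapping.keys f)"
    have le: "a' \<le> vdeg A x" if "x \<in> Poly_Mapping.keys f" for x
      using that by (simp add: a'_def)
    have "a' \<in> vdeg A ` Poly_Mapping.keys f"
      unfolding a'_def using f(1) by (intro Min_in) auto
    then obtain m' where m': "m' \<in> Poly_Mapping.keys f" "vdeg A m' = a'" by blast
    let ?part = "\<lambda>S. \<Sum>x \<in> S. Poly_Mapping.single x (Poly_Mapping.lookup f x)"
    let ?S = "{x \<in> Poly_Mapping.keys f. vdeg A x = a'}"
    let ?T = "{x \<in> Poly_Mapping.keys f. a' < vdeg A x}"
    have "f = ?part (?S \<union> ?T)"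
      using le by (subst mpoly_expand) (rule sum.cong, auto simp: order.strict_iff_order)
    also have "\<dots> = ?part ?S + ?part ?T"
      by (rule sum.union_disjoint) auto
    finally have "f = ?part ?S + ?part ?T" .
    moreover have "?part ?S \<in> mon_span {m. vdeg A m = a'}"
      by (rule mon_span_sum) (auto simp: single_in_mon_span)
    moreover have "?part ?T \<in> mon_span {m. a' < vdeg A m}"
      by (rule mon_span_sum) (auto simp: single_in_mon_span)
    moreover have "Poly_Mapping.lookup (?part ?S) m' = Poly_Mapping.lookup f m'"
      using m' by (simp add: lookup_sum lookup_single when_def sum.delta')
    then have "?part ?S \<noteq> 0"
      using m'(1) by (metis in_keys_iff lookup_zero)
    moreover have "a' \<le> a" using le[OF f(1)] f(2) by simp
    ultimately show ?thesis by blast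
  qed
  obtain a' f0 f1 where f: "a' \<le> a" "f = f0 + f1" "f0 \<noteq> 0" "f0 \<in> mon_span {m. vdeg A m = a'}"
      "f1 \<in> mon_span {m. a' < vdeg A m}"
    using split[OF assms(1,2)] by blast
  obtain b' g0 g1 where g: "b' \<le> b" "g = g0 + g1" "g0 \<noteq> 0" "g0 \<in> mon_span {m. vdeg A m = b'}"
      "g1 \<in> mon_span {m. b' < vdeg A m}"
    using split[OF assms(3,4)] by blast
  have "f0 * g0 \<noteq> 0" using f g by simp
  then obtain x where x: "x \<in> Poly_Mapping.keys (f0 * g0)"
    by (metis all_not_in_conv keys_eq_empty)
  have lead: "f0 * g0 \<in> mon_span {m. vdeg A m = a' + b'}"
    by (rule mon_span_mult[OF f(4) g(4)]) auto
  then have vx: "vdeg A x = a' + b'" using x by (auto simp: mon_span_def)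
  have "f0 * g1 \<in> mon_span {m. a' + b' < vdeg A m}" by (rule mon_span_mult[OF f(4) g(5)]) auto
  moreover have "f1 * g0 \<in> mon_span {m. a' + b' < vdeg A m}"
    by (rule mon_span_mult[OF f(5) g(4)]) auto
  moreover have "f1 * g1 \<in> mon_span {m. a' + b' < vdeg A m}"
    by (rule mon_span_mult[OF f(5) g(5)]) auto
  ultimately have "f0 * g1 + f1 * g0 + f1 * g1 \<in> mon_span {m. a' + b' < vdeg A m}"
    by (intro mon_span_add)
  then have "Poly_Mapping.lookup (f0 * g1 + f1 * g0 + f1 * g1) x = 0"
    using vx by (auto simp: mon_span_def in_keys_iff subset_iff)
  moreover have "f * g = f0 * g0 + (f0 * g1 + f1 * g0 + f1 * g1)"
    by (simp add: f(2) g(2) algebra_simps)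
  ultimately have "Poly_Mapping.lookup (f * g) x = Poly_Mapping.lookup (f0 * g0) x"
    by (simp add: lookup_add)
  then have "x \<in> Poly_Mapping.keys (f * g)" using x by (simp add: in_keys_iff)
  then show ?thesis using vx f(1) g(1) by (intro bexI[of _ x]) auto
qed

lemma primeideal_var_ideal:
  assumes "finite V" "A \<subseteq> V"
  shows "primeideal (var_ideal V A :: 'k::field mpoly set) (mpoly_ring V)"
proof -
  let ?R = "mpoly_ring V :: 'k mpoly ring"
  let ?P = "mon_span {m \<in> mons V. 1 \<le> vdeg A m} :: 'k mpoly set"
  have "primeideal ?P ?R"
  proof (rule primeidealI)
    show "ideal ?P ?R" by (intro ideal_mon_span upset_vdeg)
    show "cring ?R" by (rule mpoly_ring_cring)
    have "(1 :: 'k mpoly) \<in> polys V" "(1 :: 'k mpoly) \<notin> ?P"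
      by (auto simp: polys_eq_mon_span mon_span_def)
    then show "polys V \<noteq> ?P" by blast
    fix f g :: "'k mpoly"
    assume fg: "f \<in> polys V" "g \<in> polys V" "f \<otimes>\<^bsub>?R\<^esub> g \<in> ?P"
    show "f \<in> ?P \<or> g \<in> ?P"
    proof (rule ccontr)
      assume "\<not> ?thesis"
      then obtain m w where "m \<in> Poly_Mapping.keys f" "vdeg A m \<le> 0"
          "w \<in> Poly_Mapping.keys g" "vdeg A w \<le> 0"
        using fg(1,2) by (fastforce simp: polys_eq_mon_span mon_span_def not_le)
      from vdeg_keys_mult[OF this] show False
        using fg(3) by (auto simp: mon_span_def)
    qed
  qed
  then show ?thesis by (simp add: var_ideal_eq[OF assms])
qed

section \<open>Principal Borel ideals and the dominance order\<close>

text \<open>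
  The simplifier shall keep \<open>{1..j}\<close> instead of rewriting it to \<open>{Suc 0..j}\<close>, so that facts about initial
  segments remain applicable as stated.
\<close>

declare One_nat_def [simp del]

definition dominating :: "nat \<Rightarrow> (nat \<Rightarrow>\<^sub>0 nat) \<Rightarrow> (nat \<Rightarrow>\<^sub>0 nat) set" where
  "dominating n u = {m \<in> mons {1..n}. \<forall>j \<le> n. vdeg {1..j} u \<le> vdeg {1..j} m}"

definition expvec :: "nat \<Rightarrow> (nat \<Rightarrow> nat) \<Rightarrow> (nat \<Rightarrow>\<^sub>0 nat)" where
  "expvec p \<phi> = (\<Sum>t \<in> {1..p}. Poly_Mapping.single t (\<phi> t))"

lemma lookup_expvec: "Poly_Mapping.lookup (expvec p \<phi>) t = (if t \<in> {1..p} then \<phi> t else 0)"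
  by (simp add: expvec_def lookup_sum lookup_single when_def)

lemma expvec_in_mons: "p \<le> n \<Longrightarrow> expvec p \<phi> \<in> mons {1..n}"
  by (auto simp: mons_def in_keys_iff lookup_expvec split: if_splits)

lemma vdeg_Suc: "vdeg {1..Suc j} m = vdeg {1..j} m + Poly_Mapping.lookup m (Suc j)"
  by (simp add: vdeg_def)

lemma upset_dominating: "upset {1..n} (dominating n u)"
  by (auto simp: upset_def dominating_def intro: trans_le_add1)

lemma dominating_self: "u \<in> mons {1..n} \<Longrightarrow> u \<in> dominating n u"
  by (simp add: dominating_def)

text \<open>
  Replacing \<open>x\<^sub>j\<close> by \<open>x\<^sub>i\<close> with \<open>i < j\<close> raises exactly the partial degrees from \<open>i\<close> to \<open>j - 1\<close>; hence Borel
  moves go upwards in the dominance order.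
\<close>

lemma vdeg_borel_move:
  assumes "1 \<le> i" "i < j" "1 \<le> Poly_Mapping.lookup u j"
  shows "vdeg {1..l} (Poly_Mapping.single i 1 + (u - Poly_Mapping.single j 1)) =
           vdeg {1..l} u + (if i \<le> l \<and> l < j then 1 else 0)"
proof -
  have "vdeg {1..l} u = vdeg {1..l} (Poly_Mapping.single j 1) + vdeg {1..l} (u - Poly_Mapping.single j 1)"
    using single_plus_diff[OF assms(3)] vdeg_add by metis
  then show ?thesis
    using assms by (auto simp: vdeg_single)
qed

lemma borel_ideal_dominating: "borel_ideal n (mon_span (dominating n u))"
  unfolding borel_ideal_def
proof (intro conjI allI impI ballI)
  show "monomial_ideal {1..n} (mon_span (dominating n u))"
    using monomial_ideal_iff upset_dominating by blast
next
  fix m j i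
  assume "monomial m \<in> (mon_span (dominating n u) :: 'a mpoly set)"
    and j: "j \<in> Poly_Mapping.keys m" and i: "i \<in> {1..<j}"
  then have m: "m \<in> dominating n u" by simp
  then have "j \<in> {1..n}" using j by (auto simp: dominating_def mons_def)
  then have "Poly_Mapping.single i 1 + (m - Poly_Mapping.single j 1) \<in> mons {1..n}"
    using m i by (auto simp: dominating_def intro: mons_diff)
  moreover have "vdeg {1..l} m \<le>
      vdeg {1..l} (Poly_Mapping.single i 1 + (m - Poly_Mapping.single j 1))" for l
    using i j by (subst vdeg_borel_move) (auto simp: in_keys_iff)
  ultimately show "monomial (Poly_Mapping.single i 1 + (m - Poly_Mapping.single j 1))
      \<in> (mon_span (dominating n u) :: 'a mpoly set)"
    using m by (auto simp: dominating_def intro: order_trans)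
qed

text \<open>
  If \<open>m\<close> dominates \<open>u\<close> but is not a multiple of it, let \<open>i\<close> be the first index with \<open>m\<^sub>i < u\<^sub>i\<close>.  Since the
  partial degree of \<open>m\<close> at \<open>i\<close> is not smaller, there is \<open>j < i\<close> with \<open>m\<^sub>j > u\<^sub>j\<close>.  All partial degrees from
  \<open>j\<close> to \<open>i - 1\<close> are then strictly larger for \<open>m\<close>, so the Borel move from \<open>i\<close> to \<open>j\<close> leads from \<open>u\<close> to an
  element that \<open>m\<close> still dominates.  The sum of the gaps between the partial degrees decreases.
\<close>

lemma dominating_subset_borel:
  assumes up: "upset {1..n} E"
    and move: "\<And>u i j. u \<in> E \<Longrightarrow> j \<in> Poly_Mapping.keys u \<Longrightarrow> i \<in> {1..<j} \<Longrightarrow>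
                 Poly_Mapping.single i 1 + (u - Poly_Mapping.single j 1) \<in> E"
    and "u \<in> E" "m \<in> dominating n u"
  shows "m \<in> E"
  using assms(3,4)
proof (induction "\<Sum>l \<in> {1..n}. vdeg {1..l} m - vdeg {1..l} u" arbitrary: u rule: less_induct)
  case less
  have dom: "vdeg {1..l} u \<le> vdeg {1..l} m" if "l \<le> n" for l
    using less.prems that by (auto simp: dominating_def)
  have mm: "m \<in> mons {1..n}" and um: "u \<in> mons {1..n}"
    using less.prems up by (auto simp: dominating_def upset_def)
  show ?case
  proof (cases "\<forall>t. Poly_Mapping.lookup u t \<le> Poly_Mapping.lookup m t")
    case True
    then have "m = u + (m - u)"
      by (intro poly_mapping_eqI) (simp add: lookup_add lookup_minus)
    then show ?thesis
      using up less.prems(1) mons_diff[OF mm, of u] unfolding upset_def by metis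
  next
    case False
    define i where "i = (LEAST t. Poly_Mapping.lookup m t < Poly_Mapping.lookup u t)"
    have i: "Poly_Mapping.lookup m i < Poly_Mapping.lookup u i"
      unfolding i_def using False by (metis (mono_tags, lifting) LeastI not_le)
    have below: "Poly_Mapping.lookup u t \<le> Poly_Mapping.lookup m t" if "t < i" for t
      using that not_less_Least unfolding i_def by (metis not_le)
    have ik: "i \<in> Poly_Mapping.keys u" using i by (simp add: in_keys_iff)
    then have iV: "1 \<le> i" "i \<le> n" using um by (auto simp: mons_def)
    have "\<exists>j \<in> {1..<i}. Poly_Mapping.lookup u j < Poly_Mapping.lookup m j"
    proof (rule ccontr)
      assume "\<not> ?thesis"
      then have "Poly_Mapping.lookup m t \<le> Poly_Mapping.lookup u t" if "t \<in> {1..i}" for t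
        using that i by (metis atLeastAtMost_iff atLeastLessThan_iff le_neq_implies_less less_imp_le not_le)
      then have "vdeg {1..i} m < vdeg {1..i} u"
        unfolding vdeg_def using i iV by (intro sum_strict_mono_ex1) auto
      then show False using dom[OF iV(2)] by simp
    qed
    then obtain j where j: "j \<in> {1..<i}" "Poly_Mapping.lookup u j < Poly_Mapping.lookup m j" by blast
    let ?u = "Poly_Mapping.single j 1 + (u - Poly_Mapping.single i 1)"
    have uE: "?u \<in> E" using move[OF less.prems(1) ik j(1)] .
    have vu: "vdeg {1..l} ?u = vdeg {1..l} u + (if j \<le> l \<and> l < i then 1 else 0)" for l
      using j i by (intro vdeg_borel_move) auto
    have strict: "vdeg {1..l} u < vdeg {1..l} m" if "j \<le> l" "l < i" for l
      unfolding vdeg_def using that j below by (intro sum_strict_mono_ex1) auto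
    have le: "vdeg {1..l} ?u \<le> vdeg {1..l} m" if "l \<le> n" for l
      using strict[of l] dom[OF that] unfolding vu by auto
    have "(\<Sum>l \<in> {1..n}. vdeg {1..l} m - vdeg {1..l} ?u) < (\<Sum>l \<in> {1..n}. vdeg {1..l} m - vdeg {1..l} u)"
    proof (rule sum_strict_mono_ex1)
      show "\<forall>l \<in> {1..n}. vdeg {1..l} m - vdeg {1..l} ?u \<le> vdeg {1..l} m - vdeg {1..l} u"
        by (simp only: vu) auto
      have "vdeg {1..j} m - vdeg {1..j} ?u < vdeg {1..j} m - vdeg {1..j} u"
        using strict[of j] j by (simp only: vu) auto
      then show "\<exists>l \<in> {1..n}. vdeg {1..l} m - vdeg {1..l} ?u < vdeg {1..l} m - vdeg {1..l} u"
        using j iV by (intro bexI[of _ j]) auto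
    qed simp
    then show ?thesis
    proof (rule less.hyps[OF _ uE])
      show "m \<in> dominating n ?u" using mm le by (auto simp: dominating_def)
    qed
  qed
qed

text \<open>
  The dominance set of \<open>u\<close> spans a Borel ideal, and by the previous lemma it is contained in every
  Borel ideal containing \<open>u\<close>.
\<close>

lemma principal_borel_iff:
  fixes I :: "'k::field mpoly set"
  shows "principal_borel n I \<longleftrightarrow> (\<exists>u \<in> mons {1..n}. I = mon_span (dominating n u))"
proof -
  have least: "mon_span (dominating n u) \<subseteq> J"
    if J: "borel_ideal n J" "monomial u \<in> J" for u and J :: "'k mpoly set"
  proof -
    obtain E where E: "upset {1..n} E" "J = mon_span E"
      using J(1) by (auto simp: borel_ideal_def monomial_ideal_iff)
    have u: "u \<in> E" using J(2) E(2) by simp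
    have move: "Poly_Mapping.single i 1 + (v - Poly_Mapping.single j 1) \<in> E"
      if "v \<in> E" "j \<in> Poly_Mapping.keys v" "i \<in> {1..<j}" for v i j
    proof -
      have "\<forall>v. monomial v \<in> J \<longrightarrow> (\<forall>j \<in> Poly_Mapping.keys v. \<forall>i \<in> {1..<j}.
          monomial (Poly_Mapping.single i 1 + (v - Poly_Mapping.single j 1)) \<in> J)"
        using J(1) unfolding borel_ideal_def by blast
      then show ?thesis
        using that unfolding E(2) monomial_in_mon_span by blast
    qed
    have "dominating n u \<subseteq> E"
      using dominating_subset_borel[OF E(1) move u] by blast
    then show ?thesis unfolding E(2) by (rule mon_span_mono)
  qed
  show ?thesis
  proof
    assume "principal_borel n I"
    then obtain u where u: "u \<in> mons {1..n}" "borel_ideal n I" "monomial u \<in> I"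
      and min: "\<And>J. borel_ideal n J \<Longrightarrow> monomial u \<in> J \<Longrightarrow> I \<subseteq> J"
      by (auto simp: principal_borel_def mons_def)
    have "I \<subseteq> mon_span (dominating n u)"
      using dominating_self[OF u(1)] by (intro min borel_ideal_dominating) simp
    then show "\<exists>u \<in> mons {1..n}. I = mon_span (dominating n u)"
      using least[OF u(2,3)] u(1) by blast
  next
    assume "\<exists>u \<in> mons {1..n}. I = mon_span (dominating n u)"
    then obtain u where u: "u \<in> mons {1..n}" and I: "I = mon_span (dominating n u)" by blast
    show "principal_borel n I"
      unfolding principal_borel_def I
    proof (intro exI[of _ u] conjI allI impI)
      show "Poly_Mapping.keys u \<subseteq> {1..n}" using u by (simp add: mons_def)
      show "monomial u \<in> (mon_span (dominating n u) :: 'k mpoly set)"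
        using dominating_self[OF u] by simp
    qed (use least borel_ideal_dominating in blast)+
  qed
qed


section \<open>Intersections of monomial prime powers that are of Borel type\<close>

text \<open>
  Here \<open>E\<close> is the exponent set of the intersection of the powers \<open>P\<^sub>A\<^sup>d\<close> for \<open>(A, d)\<close> in \<open>F\<close>, and
  \<open>sat i\<close> that of its saturation at \<open>(x\<^sub>1, \<dots>, x\<^sub>i)\<close>.  By the Borel type condition the latter is also
  the saturation at \<open>x\<^sub>i\<close>, and therefore closed under dividing by \<open>x\<^sub>i\<close>.
\<close>

lemma borel_type_strip_variable:
  fixes F :: "(nat set \<times> nat) set" and n :: nat
  defines "E \<equiv> {m \<in> mons {1..n}. \<forall>(A, d) \<in> F. d \<le> vdeg A m}"
    and "sat \<equiv> \<lambda>i. {m \<in> mons {1..n}. \<forall>(A, d) \<in> F. \<not> {1..i} \<subseteq> A \<longrightarrow> d \<le> vdeg A m}"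
  assumes F: "\<And>A d. (A, d) \<in> F \<Longrightarrow> A \<subseteq> {1..n} \<and> d \<le> B"
    and borel: "\<And>m. m \<in> mons {1..n} \<Longrightarrow> \<exists>k. \<forall>w \<in> mons {1..n}. k \<le> vdeg {i} w \<longrightarrow> m + w \<in> E \<Longrightarrow>
        \<exists>k. \<forall>w \<in> mons {1..n}. k \<le> vdeg {1..i} w \<longrightarrow> m + w \<in> E"
    and i: "i \<in> {1..n}"
    and m: "m \<in> sat i" "m' + Poly_Mapping.single i a = m"
  shows "m' \<in> sat i"
proof -
  have fin: "finite A" if "(A, d) \<in> F" for A d
    using F[OF that] finite_subset by blast
  have m': "m' \<in> mons {1..n}" using m by (auto simp: sat_def)
  have "m' + w \<in> E" if w: "w \<in> mons {1..n}" "B \<le> vdeg {i} w" for w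
  proof -
    have "d \<le> vdeg A (m' + w)" if Ad: "(A, d) \<in> F" for A d
    proof (cases "i \<in> A")
      case True
      then have "vdeg {i} w \<le> vdeg A w" using fin[OF Ad] by (intro vdeg_mono) auto
      then show ?thesis using F[OF Ad] w(2) by simp
    next
      case False
      then have "\<not> {1..i} \<subseteq> A" using i by auto
      then have "d \<le> vdeg A m" using m(1) Ad by (auto simp: sat_def)
      also have "\<dots> = vdeg A m'"
        using False fin[OF Ad] by (simp add: vdeg_single flip: m(2))
      finally show ?thesis by simp
    qed
    then show ?thesis using m' w by (auto simp: E_def)
  qed
  then obtain k where k: "\<And>w. w \<in> mons {1..n} \<Longrightarrow> k \<le> vdeg {1..i} w \<Longrightarrow> m' + w \<in> E"
    using borel[OF m'] by blast
  have "d \<le> vdeg A m'" if Ad: "(A, d) \<in> F" "\<not> {1..i} \<subseteq> A" for A d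
  proof -
    obtain t where t: "t \<in> {1..i}" "t \<notin> A" using Ad(2) by blast
    have "m' + Poly_Mapping.single t k \<in> E"
      using t i by (intro k) (auto simp: vdeg_single)
    then have "d \<le> vdeg A (m' + Poly_Mapping.single t k)" using Ad(1) by (auto simp: E_def)
    then show ?thesis using t fin[OF Ad(1)] by (simp add: vdeg_single)
  qed
  then show ?thesis using m' by (auto simp: sat_def)
qed

text \<open>
  The saturations at \<open>(x\<^sub>1, \<dots>, x\<^sub>q)\<close> increase when \<open>q\<close> decreases.  So one can start with \<open>m\<close>, strip \<open>x\<^sub>n\<close>,
  pass to the saturation for \<open>n - 1\<close>, strip \<open>x\<^sub>n\<^sub>-\<^sub>1\<close>, and continue down to \<open>x\<^sub>p\<^sub>+\<^sub>1\<close>.  What remains of \<open>m\<close>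
  still satisfies the condition \<open>(A, d)\<close>, since \<open>{1..p + 1}\<close> is not contained in \<open>A\<close>.
\<close>

lemma borel_type_prefix:
  fixes F :: "(nat set \<times> nat) set" and n :: nat
  defines "E \<equiv> {m \<in> mons {1..n}. \<forall>(A, d) \<in> F. d \<le> vdeg A m}"
  assumes F: "\<And>A d. (A, d) \<in> F \<Longrightarrow> A \<subseteq> {1..n} \<and> d \<le> B"
    and borel: "\<And>m i. i \<in> {1..n} \<Longrightarrow> m \<in> mons {1..n} \<Longrightarrow>
        \<exists>k. \<forall>w \<in> mons {1..n}. k \<le> vdeg {i} w \<longrightarrow> m + w \<in> E \<Longrightarrow>
        \<exists>k. \<forall>w \<in> mons {1..n}. k \<le> vdeg {1..i} w \<longrightarrow> m + w \<in> E"
    and m: "m \<in> E" and Ad: "(A, d) \<in> F" and p: "Suc p \<le> n" "\<not> {1..Suc p} \<subseteq> A"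
  shows "d \<le> vdeg {1..p} m"
proof -
  define sat where "sat = (\<lambda>i. {m \<in> mons {1..n}. \<forall>(A, d) \<in> F. \<not> {1..i} \<subseteq> A \<longrightarrow> d \<le> vdeg A m})"
  let ?t = "\<lambda>p. expvec p (Poly_Mapping.lookup m)"
  have strip: "?t p \<in> sat (Suc p)" if "Suc p \<le> n" "?t (Suc p) \<in> sat (Suc p)" for p
    unfolding sat_def
  proof (rule borel_type_strip_variable[OF F])
    show "?t p + Poly_Mapping.single (Suc p) (Poly_Mapping.lookup m (Suc p)) = ?t (Suc p)"
      by (simp add: expvec_def)
  qed (use that borel in \<open>auto simp: sat_def E_def\<close>)
  have mm: "m \<in> mons {1..n}" using m by (simp add: E_def)
  have "?t n = m"
    using mm by (intro mons_eqI[OF expvec_in_mons]) (auto simp: lookup_expvec)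
  have "p \<le> n - 1" using p by simp
  then have "?t p \<in> sat (Suc p)"
  proof (induction rule: inc_induct)
    case base
    have "m \<in> sat n" using m by (auto simp: sat_def E_def)
    then show ?case
      using strip[of "n - 1"] p \<open>?t n = m\<close> by simp
  next
    case (step q)
    have "?t (Suc q) \<in> sat (Suc (Suc q))" by fact
    then have "?t (Suc q) \<in> sat (Suc q)" by (force simp: sat_def)
    then show ?case using strip[of q] step.hyps by simp
  qed
  then have "d \<le> vdeg A (?t p)" using Ad p by (auto simp: sat_def)
  also have "\<dots> \<le> vdeg ({1..n} \<inter> {1..p}) (?t p)"
  proof -
    have "vdeg A (?t p) = vdeg (A \<inter> {1..p}) (?t p)"
      unfolding vdeg_def using F[OF Ad] finite_subset
      by (intro sum.mono_neutral_right) (auto simp: lookup_expvec)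
    also have "\<dots> \<le> vdeg ({1..n} \<inter> {1..p}) (?t p)"
      using F[OF Ad] by (intro vdeg_mono) auto
    finally show ?thesis .
  qed
  also have "{1..n} \<inter> {1..p} = {1..p}" using p by auto
  also have "vdeg {1..p} (?t p) = vdeg {1..p} m"
    unfolding vdeg_def by (intro sum.cong) (auto simp: lookup_expvec)
  finally show ?thesis .
qed

text \<open>
  The largest bound \<open>c j\<close> imposed on some initial segment inside \<open>{1..j}\<close> is monotone in \<open>j\<close>, and \<open>c 0 = 0\<close>
  because \<open>E\<close> is not empty.  Hence \<open>c\<close> is the sequence of partial degrees of an exponent vector \<open>u\<close>.
\<close>

lemma prefix_conditions_dominating:
  fixes F :: "(nat \<times> nat) set" and n :: nat
  defines "E \<equiv> {m \<in> mons {1..n}. \<forall>(p, d) \<in> F. d \<le> vdeg {1..p} m}"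
  assumes F: "finite F" "\<And>p d. (p, d) \<in> F \<Longrightarrow> p \<le> n" and "E \<noteq> {}"
  shows "\<exists>u \<in> mons {1..n}. E = dominating n u"
proof -
  define c where "c = (\<lambda>j. Max (insert 0 (snd ` {x \<in> F. fst x \<le> j})))"
  have c_ge: "d \<le> c j" if "(p, d) \<in> F" "p \<le> j" for p d j
    unfolding c_def using F(1) that by (intro Max_ge) force+
  have c_le: "c j \<le> b" if "\<And>p d. (p, d) \<in> F \<Longrightarrow> p \<le> j \<Longrightarrow> d \<le> b" for j b
    unfolding c_def using F(1) that by (subst Max_le_iff) auto
  have c_mono: "c i \<le> c j" if "i \<le> j" for i j
    using that c_ge by (meson c_le order_trans)
  obtain m0 where m0: "m0 \<in> E" using assms by blast
  have "c 0 \<le> 0"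
  proof (rule c_le)
    fix p d assume "(p, d) \<in> F" "p \<le> 0"
    then show "d \<le> 0" using m0 by (fastforce simp: E_def)
  qed
  define u where "u = expvec n (\<lambda>t. c t - c (t - 1))"
  have vu: "vdeg {1..j} u = c j" if "j \<le> n" for j
    using that
  proof (induction j)
    case 0
    then show ?case using \<open>c 0 \<le> 0\<close> by simp
  next
    case (Suc j)
    then show ?case
      using c_mono[of j "Suc j"] by (simp add: vdeg_Suc u_def lookup_expvec del: One_nat_def)
  qed
  have "m \<in> E \<longleftrightarrow> m \<in> dominating n u" for m
  proof
    assume m: "m \<in> E"
    have "c j \<le> vdeg {1..j} m" for j
    proof (rule c_le)
      fix p d assume pd: "(p, d) \<in> F" "p \<le> j"
      then have "d \<le> vdeg {1..p} m" using m by (auto simp: E_def)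
      also have "\<dots> \<le> vdeg {1..j} m" using pd(2) by (intro vdeg_mono) auto
      finally show "d \<le> vdeg {1..j} m" .
    qed
    then show "m \<in> dominating n u" using m by (auto simp: dominating_def E_def vu)
  next
    assume m: "m \<in> dominating n u"
    have "d \<le> vdeg {1..p} m" if "(p, d) \<in> F" for p d
      using c_ge[OF that order_refl] m F(2)[OF that] vu[of p] by (fastforce simp: dominating_def)
    then show "m \<in> E" using m by (auto simp: dominating_def E_def)
  qed
  moreover have "u \<in> mons {1..n}" unfolding u_def by (rule expvec_in_mons) simp
  ultimately show ?thesis by blast
qed

lemma prime_powers_membership:
  fixes F :: "('k::field mpoly set \<times> nat) set"
  assumes "finite V" "\<And>P d. (P, d) \<in> F \<Longrightarrow> monomial_prime V P"
  shows "monomial m \<in> polys V \<inter> (\<Inter>(P, d) \<in> F. ideal_power V P d) \<longleftrightarrow>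
           m \<in> mons V \<and> (\<forall>(A, d) \<in> {(A, d). A \<subseteq> V \<and> (var_ideal V A, d) \<in> F}. d \<le> vdeg A m)"
    (is "?L \<longleftrightarrow> ?R")
proof
  assume L: ?L
  show ?R
  proof (intro conjI ballI)
    show "m \<in> mons V" using L by simp
    fix x assume "x \<in> {(A, d). A \<subseteq> V \<and> (var_ideal V A, d) \<in> F}"
    then obtain A d where x: "x = (A, d)" "A \<subseteq> V" "(var_ideal V A, d) \<in> F" by blast
    have "(monomial m :: 'k mpoly) \<in> ideal_power V (var_ideal V A) d"
      using INT_D[OF IntD2[OF L] x(3)] by simp
    then show "case x of (A, d) \<Rightarrow> d \<le> vdeg A m"
      by (simp add: x(1) ideal_power_var_ideal[OF assms(1) x(2)])
  qed
next
  assume R: ?R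
  have "monomial m \<in> ideal_power V P d" if Pd: "(P, d) \<in> F" for P d
  proof -
    obtain A where A: "A \<subseteq> V" "P = var_ideal V A"
      using assms(2)[OF Pd] by (auto simp: monomial_prime_def)
    then show ?thesis using R Pd by (simp add: ideal_power_var_ideal[OF assms(1) A(1)])
  qed
  then show ?L using R by auto
qed

text \<open>
  The prefix of a set \<open>A\<close> of variables is the longest initial segment contained in it.  Shrinking every
  \<open>A\<close> to its prefix strengthens the conditions, but does not change the ideal by \<open>borel_type_prefix\<close>.
\<close>

theorem borel_type_intersection_type_imp_principal_borel:
  fixes I :: "'k::field mpoly set"
  assumes "borel_type n I" "I \<noteq> {0}" "intersection_type {1..n} I"
  shows "principal_borel n I"
proof -
  let ?V = "{1..n}"
  obtain E where E: "upset ?V E" "I = mon_span E"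
    using assms(1) by (auto simp: borel_type_def monomial_ideal_iff)
  have "E \<noteq> {}" using assms(2) E(2) by (auto simp: mon_span_def)
  obtain F :: "('k mpoly set \<times> nat) set" where F: "finite F" "\<And>P d. (P, d) \<in> F \<Longrightarrow> monomial_prime ?V P"
    and I: "I = polys ?V \<inter> (\<Inter>(P, d) \<in> F. ideal_power ?V P d)"
    using assms(3) by (auto simp: intersection_type_def)
  define F' where "F' = {(A, d). A \<subseteq> ?V \<and> (var_ideal ?V A, d) \<in> F}"
  have E_eq: "E = {m \<in> mons ?V. \<forall>(A, d) \<in> F'. d \<le> vdeg A m}"
  proof (rule Set.set_eqI)
    fix m
    have "m \<in> E \<longleftrightarrow> (monomial m :: 'k mpoly) \<in> I" by (simp add: E(2))
    also have "\<dots> \<longleftrightarrow> m \<in> mons ?V \<and> (\<forall>(A, d) \<in> F'. d \<le> vdeg A m)"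
      unfolding I F'_def by (rule prime_powers_membership[OF finite_atLeastAtMost F(2)])
    finally show "m \<in> E \<longleftrightarrow> m \<in> {m \<in> mons ?V. \<forall>(A, d) \<in> F'. d \<le> vdeg A m}" by simp
  qed
  define B where "B = Max (insert 0 (snd ` F))"
  have F'_bd: "A \<subseteq> ?V \<and> d \<le> B" if "(A, d) \<in> F'" for A d
    unfolding B_def using that F(1) by (auto simp: F'_def intro!: Max_ge) force
  have "F' \<subseteq> Pow ?V \<times> {..B}" using F'_bd by auto
  then have finF': "finite F'" by (rule finite_subset) simp
  have borel: "\<exists>k. \<forall>w \<in> mons ?V. k \<le> vdeg {1..i} w \<longrightarrow> m + w \<in> E"
    if "i \<in> ?V" "m \<in> mons ?V" "\<exists>k. \<forall>w \<in> mons ?V. k \<le> vdeg {i} w \<longrightarrow> m + w \<in> E" for m i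
  proof -
    have "{i} \<subseteq> ?V" "{1..i} \<subseteq> ?V" using that by auto
    note sat = this[THEN monomial_in_saturation_iff[OF finite_atLeastAtMost, where E = E and m = m and 'k = 'k]]
    have "saturation ?V I (var_ideal ?V {i}) = saturation ?V I (var_ideal ?V {1..i})"
      using assms(1) that(1) by (simp add: borel_type_def)
    then show ?thesis using sat that(2,3) E(2) by blast
  qed
  define pre where "pre = (\<lambda>A. Max {p. p \<le> n \<and> {1..p} \<subseteq> A})"
  have pre: "pre A \<le> n" "{1..pre A} \<subseteq> A" for A
  proof -
    have "pre A \<in> {p. p \<le> n \<and> {1..p} \<subseteq> A}"
      unfolding pre_def by (rule Max_in) (auto intro: exI[of _ 0])
    then show "pre A \<le> n" "{1..pre A} \<subseteq> A" by auto
  qed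
  have pre_max: "\<not> {1..Suc (pre A)} \<subseteq> A" if "Suc (pre A) \<le> n" for A
  proof
    assume "{1..Suc (pre A)} \<subseteq> A"
    then have "Suc (pre A) \<le> pre A"
      using that unfolding pre_def by (intro Max_ge) auto
    then show False by simp
  qed
  have "m \<in> E \<longleftrightarrow> m \<in> mons ?V \<and> (\<forall>(p, d) \<in> (\<lambda>(A, d). (pre A, d)) ` F'. d \<le> vdeg {1..p} m)" for m
  proof
    assume m: "m \<in> E"
    have "d \<le> vdeg {1..pre A} m" if Ad: "(A, d) \<in> F'" for A d
    proof (cases "pre A = n")
      case True
      then have "A = {1..pre A}" using pre(2)[of A] F'_bd[OF Ad] by auto
      then show ?thesis using m Ad by (auto simp: E_eq)
    next
      case False
      then have "Suc (pre A) \<le> n" using pre(1)[of A] by simp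
      then show ?thesis
        using borel m pre_max Ad unfolding E_eq
        by (intro borel_type_prefix[where F = F' and n = n and B = B and A = A, OF F'_bd]) blast+
    qed
    then show "m \<in> mons ?V \<and> (\<forall>(p, d) \<in> (\<lambda>(A, d). (pre A, d)) ` F'. d \<le> vdeg {1..p} m)"
      using m by (auto simp: E_eq)
  next
    assume R: "m \<in> mons ?V \<and> (\<forall>(p, d) \<in> (\<lambda>(A, d). (pre A, d)) ` F'. d \<le> vdeg {1..p} m)"
    have "d \<le> vdeg A m" if Ad: "(A, d) \<in> F'" for A d
    proof -
      have "d \<le> vdeg {1..pre A} m" using R Ad by auto
      also have "\<dots> \<le> vdeg A m"
        using pre(2) F'_bd[OF Ad] finite_subset by (intro vdeg_mono) blast+
      finally show ?thesis .
    qed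
    then show "m \<in> E" using R by (auto simp: E_eq)
  qed
  then have E_prefix: "E = {m \<in> mons ?V. \<forall>(p, d) \<in> (\<lambda>(A, d). (pre A, d)) ` F'. d \<le> vdeg {1..p} m}"
    by blast
  have "\<exists>u \<in> mons ?V. E = dominating n u"
    unfolding E_prefix
  proof (rule prefix_conditions_dominating)
    show "p \<le> n" if "(p, d) \<in> (\<lambda>(A, d). (pre A, d)) ` F'" for p d
      using that pre(1) by auto
  qed (use finF' \<open>E \<noteq> {}\<close> E_prefix in \<open>simp_all only: finite_imageI not_False_eq_True\<close>)
  then show ?thesis unfolding principal_borel_iff E(2) by auto
qed

section \<open>Associated primes of a principal Borel ideal\<close>

lemma mult_monomial_expand:
  "g * monomial w = (\<Sum>m \<in> Poly_Mapping.keys g. Poly_Mapping.single (m + w) (Poly_Mapping.lookup g m))"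
  by (subst (1) mpoly_expand[of g]) (simp add: sum_distrib_right monomial_def mult_single)

lemma lookup_mult_monomial: "Poly_Mapping.lookup (g * monomial w) (m + w) = Poly_Mapping.lookup g m"
  by (auto simp: mult_monomial_expand lookup_sum lookup_single when_def sum.delta in_keys_iff)

lemma keys_mult_monomial: "Poly_Mapping.keys (g * monomial w) = (\<lambda>m. m + w) ` Poly_Mapping.keys g"
proof
  show "Poly_Mapping.keys (g * monomial w) \<subseteq> (\<lambda>m. m + w) ` Poly_Mapping.keys g"
    using keys_mult[of g "monomial w"] by (auto simp: monomial_def)
  show "(\<lambda>m. m + w) ` Poly_Mapping.keys g \<subseteq> Poly_Mapping.keys (g * monomial w)"
    by (auto simp: in_keys_iff lookup_mult_monomial)
qed

lemma mult_monomial_in_mon_span: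
  "g * monomial w \<in> mon_span E \<longleftrightarrow> (\<forall>m \<in> Poly_Mapping.keys g. m + w \<in> E)"
  by (auto simp: mon_span_def keys_mult_monomial)

text \<open>
  At an index outside the support of \<open>u\<close> the partial degree of \<open>u\<close> does not grow, so that the
  condition there follows from the previous one.  Only these conditions remain in the canonical
  decomposition.
\<close>

lemma dominating_iff_support:
  assumes "u \<in> mons {1..n}"
  shows "m \<in> dominating n u \<longleftrightarrow>
           m \<in> mons {1..n} \<and> (\<forall>i \<in> Poly_Mapping.keys u. vdeg {1..i} u \<le> vdeg {1..i} m)"
proof
  assume "m \<in> dominating n u"
  then show "m \<in> mons {1..n} \<and> (\<forall>i \<in> Poly_Mapping.keys u. vdeg {1..i} u \<le> vdeg {1..i} m)"
    using assms by (auto simp: dominating_def mons_def)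
next
  assume R: "m \<in> mons {1..n} \<and> (\<forall>i \<in> Poly_Mapping.keys u. vdeg {1..i} u \<le> vdeg {1..i} m)"
  have "vdeg {1..j} u \<le> vdeg {1..j} m" for j
  proof (induction j)
    case (Suc j)
    show ?case
    proof (cases "Suc j \<in> Poly_Mapping.keys u")
      case True
      then show ?thesis using R by blast
    next
      case False
      then show ?thesis using Suc.IH by (simp add: vdeg_Suc in_keys_iff)
    qed
  qed simp
  then show "m \<in> dominating n u" using R by (simp add: dominating_def)
qed

text \<open>
  The witness is \<open>u x\<^sub>i\<^sub>+\<^sub>1 / x\<^sub>i\<close>, or \<open>u / x\<^sub>n\<close> if \<open>i = n\<close>.  It violates the condition at \<open>i\<close> by one and satisfies
  all others with equality.  So \<open>(x\<^sub>1, \<dots>, x\<^sub>i)\<close> is the annihilator of its residue class, and the component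
  at \<open>i\<close> cannot be left out of the decomposition.
\<close>

lemma one_step_below:
  assumes "u \<in> mons {1..n}" "i \<in> Poly_Mapping.keys u"
  obtains w where "w \<in> mons {1..n}"
    "\<And>l. l \<le> n \<Longrightarrow> vdeg {1..l} w + (if l = i then 1 else 0) = vdeg {1..l} u"
proof
  \<comment> \<open>For \<open>i = n\<close> there is no next variable, and no partial degree beyond \<open>i\<close> to restore.\<close>
  let ?e = "if i < n then Poly_Mapping.single (Suc i) 1 else (0 :: nat \<Rightarrow>\<^sub>0 nat)"
  let ?w = "(u - Poly_Mapping.single i 1) + ?e"
  have i: "1 \<le> i" "i \<le> n" using assms by (auto simp: mons_def)
  then show "?w \<in> mons {1..n}" using assms by (auto intro: mons_diff)
  fix l assume "l \<le> n"
  have "Poly_Mapping.single i 1 + (u - Poly_Mapping.single i 1) = u"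
    using assms(2) by (intro single_plus_diff) (simp add: in_keys_iff)
  then have "vdeg {1..l} u = vdeg {1..l} (Poly_Mapping.single i 1) + vdeg {1..l} (u - Poly_Mapping.single i 1)"
    using vdeg_add by metis
  then show "vdeg {1..l} ?w + (if l = i then 1 else 0) = vdeg {1..l} u"
    using i \<open>l \<le> n\<close> by (auto simp: vdeg_single)
qed

abbreviation prefix_prime :: "nat \<Rightarrow> nat \<Rightarrow> 'k::field mpoly set" where
  "prefix_prime n i \<equiv> var_ideal {1..n} {1..i}"

lemma prefix_prime_eq:
  "i \<le> n \<Longrightarrow> prefix_prime n i = mon_span {m \<in> mons {1..n}. 1 \<le> vdeg {1..i} m}"
  by (rule var_ideal_eq) auto

lemma X_in_prefix_prime: "i \<le> n \<Longrightarrow> X k \<in> prefix_prime n i \<longleftrightarrow> k \<in> {1..i}"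
  by (auto simp: prefix_prime_eq X_def vdeg_single split: if_splits)

lemma loc_vars_prefix_prime: "i \<le> n \<Longrightarrow> loc_vars {1..n} (prefix_prime n i) = {1..i}"
  by (auto simp: loc_vars_def X_in_prefix_prime)

lemma monomial_prime_prefix_prime: "i \<le> n \<Longrightarrow> monomial_prime {1..n} (prefix_prime n i)"
  unfolding monomial_prime_def by (intro conjI primeideal_var_ideal exI[of _ "{1..i}"]) auto

lemma Inter_prefix_powers:
  assumes "K \<subseteq> {1..n}"
  shows "polys {1..n} \<inter> (\<Inter>P \<in> prefix_prime n ` K. ideal_power {1..n} P (vdeg (loc_vars {1..n} P) u)) =
           (mon_span {m \<in> mons {1..n}. \<forall>i \<in> K. vdeg {1..i} u \<le> vdeg {1..i} m} :: 'k::field mpoly set)"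
proof -
  have "ideal_power {1..n} (prefix_prime n i) (vdeg (loc_vars {1..n} (prefix_prime n i :: 'k mpoly set)) u) =
          (mon_span {m \<in> mons {1..n}. vdeg {1..i} u \<le> vdeg {1..i} m} :: 'k mpoly set)" if "i \<in> K" for i
    using that assms by (subst ideal_power_var_ideal) (auto simp: loc_vars_prefix_prime subset_iff)
  then have "polys {1..n} \<inter> (\<Inter>P \<in> prefix_prime n ` K. ideal_power {1..n} P (vdeg (loc_vars {1..n} P) u)) =
          polys {1..n} \<inter> (\<Inter>i \<in> K. mon_span {m \<in> mons {1..n}. vdeg {1..i} u \<le> vdeg {1..i} m} :: 'k mpoly set)"
    by simp
  also have "\<dots> = mon_span {m \<in> mons {1..n}. \<forall>i \<in> K. vdeg {1..i} u \<le> vdeg {1..i} m}"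
    by (auto simp: polys_eq_mon_span mon_span_def)
  finally show ?thesis .
qed

lemma prefix_prime_is_associated:
  assumes u: "u \<in> mons {1..n}" "i \<in> Poly_Mapping.keys u"
  shows "(prefix_prime n i :: 'k::field mpoly set) \<in> ass_primes {1..n} (mon_span (dominating n u))"
proof -
  have i: "i \<le> n" using u by (auto simp: mons_def)
  obtain w where w: "w \<in> mons {1..n}"
    "\<And>l. l \<le> n \<Longrightarrow> vdeg {1..l} w + (if l = i then 1 else 0) = vdeg {1..l} u"
    using one_step_below[OF u] by blast
  have "m + w \<in> dominating n u \<longleftrightarrow> 1 \<le> vdeg {1..i} m" if "m \<in> mons {1..n}" for m
  proof -
    have "vdeg {1..l} u \<le> vdeg {1..l} (m + w) \<longleftrightarrow> (l = i \<longrightarrow> 1 \<le> vdeg {1..l} m)" if "l \<le> n" for l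
      using w(2)[OF that] by (auto split: if_splits)
    then show ?thesis using that w(1) i by (auto simp: dominating_def)
  qed
  then have "prefix_prime n i = {g \<in> polys {1..n}. g * (monomial w :: 'k mpoly) \<in> mon_span (dominating n u)}"
    unfolding prefix_prime_eq[OF i] mult_monomial_in_mon_span polys_iff
    by (auto simp: mon_span_def subset_iff)
  moreover have "monomial w \<in> polys {1..n}" using w by simp
  moreover have "primeideal (prefix_prime n i :: 'k mpoly set) (mpoly_ring {1..n})"
    by (rule primeideal_var_ideal) (use i in auto)
  ultimately show ?thesis
    unfolding ass_primes_def by blast
qed

text \<open>
  Let \<open>Q\<close> be the annihilator of \<open>f\<close>, and let \<open>i\<close> be the smallest index whose primary component does not
  contain \<open>f\<close>.  Primary components being primary, \<open>Q\<close> is contained in \<open>(x\<^sub>1, \<dots>, x\<^sub>i)\<close>.  Conversely, a high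
  power of \<open>x\<^sub>t\<close> with \<open>t \<le> i\<close> lies in all components from the \<open>i\<close>-th on, and \<open>f\<close> lies in the others; so the
  power belongs to the prime \<open>Q\<close>, and \<open>x\<^sub>t\<close> as well.
\<close>

lemma associated_prime_is_prefix_prime:
  fixes Q :: "'k::field mpoly set"
  assumes u: "u \<in> mons {1..n}" and Q: "Q \<in> ass_primes {1..n} (mon_span (dominating n u))"
  shows "Q \<in> prefix_prime n ` Poly_Mapping.keys u"
proof -
  let ?R = "mpoly_ring {1..n} :: 'k mpoly ring"
  let ?I = "mon_span (dominating n u) :: 'k mpoly set"
  obtain f where f: "f \<in> polys {1..n}" and Qf: "Q = {g \<in> polys {1..n}. g * f \<in> ?I}"
    and prime: "primeideal Q ?R"
    using Q by (auto simp: ass_primes_def)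
  have mem: "h \<in> ?I \<longleftrightarrow> (\<forall>i \<in> Poly_Mapping.keys u. \<forall>x \<in> Poly_Mapping.keys h. vdeg {1..i} u \<le> vdeg {1..i} x)"
    if "h \<in> polys {1..n}" for h
    using that by (auto simp: mon_span_def dominating_iff_support[OF u] polys_iff subset_iff)
  have idQ: "ideal Q ?R" using prime by (rule primeideal.axioms(1))
  have one: "1 \<notin> Q"
    using primeideal.I_notcarr[OF prime] ideal.one_imp_carrier[OF idQ] by auto
  have "f \<notin> ?I"
  proof
    assume "f \<in> ?I"
    then have "1 \<in> Q" unfolding Qf by (simp add: polys_iff)
    then show False using one by blast
  qed
  define T where "T = {i \<in> Poly_Mapping.keys u. \<exists>x \<in> Poly_Mapping.keys f. vdeg {1..i} x < vdeg {1..i} u}"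
  have "T \<noteq> {}" using \<open>f \<notin> ?I\<close> mem[OF f] by (force simp: T_def not_le)
  have "finite T" by (simp add: T_def)
  define i where "i = Min T"
  have "i \<in> T" using \<open>T \<noteq> {}\<close> \<open>finite T\<close> by (simp add: i_def)
  then obtain x where iu: "i \<in> Poly_Mapping.keys u" and x: "x \<in> Poly_Mapping.keys f" "vdeg {1..i} x < vdeg {1..i} u"
    by (auto simp: T_def)
  have i: "1 \<le> i" "i \<le> n" using u iu by (auto simp: mons_def)
  have "Q \<subseteq> prefix_prime n i"
  proof
    fix g assume "g \<in> Q"
    then have g: "g \<in> polys {1..n}" "g * f \<in> ?I" by (auto simp: Qf)
    have "1 \<le> vdeg {1..i} m" if m: "m \<in> Poly_Mapping.keys g" for m
    proof (rule ccontr)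
      assume "\<not> 1 \<le> vdeg {1..i} m"
      then have "\<exists>y \<in> Poly_Mapping.keys (g * f). vdeg {1..i} y \<le> 0 + vdeg {1..i} x"
        using m x by (intro vdeg_keys_mult[of m g _ _ x]) auto
      moreover have "vdeg {1..i} u \<le> vdeg {1..i} y" if "y \<in> Poly_Mapping.keys (g * f)" for y
        using g(2) that i by (auto simp: mon_span_def dominating_def)
      ultimately show False using x(2) by fastforce
    qed
    then show "g \<in> prefix_prime n i"
      using g(1) by (auto simp: prefix_prime_eq[OF i(2)] mon_span_def polys_iff)
  qed
  moreover have "prefix_prime n i \<subseteq> Q"
    unfolding var_ideal_def
  proof (rule ring.genideal_minimal)
    show "ring ?R" using mpoly_ring_cring by (rule cring.axioms(1))
    show "ideal Q ?R" by (rule idQ)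
    have "X t \<in> Q" if t: "t \<in> {1..i}" for t
    proof -
      define N where "N = vdeg {1..n} u"
      let ?p = "\<lambda>N. monomial (Poly_Mapping.single t N) :: 'k mpoly"
      have p: "?p N \<in> polys {1..n}" for N using t i by simp
      have "vdeg {1..j} u \<le> vdeg {1..j} (m + Poly_Mapping.single t N)"
        if m: "m \<in> Poly_Mapping.keys f" and j: "j \<in> Poly_Mapping.keys u" for m j
      proof (cases "j \<in> T")
        case True
        then have "i \<le> j" using \<open>finite T\<close> by (simp add: i_def)
        moreover have "j \<le> n" using j u by (auto simp: mons_def)
        then have "vdeg {1..j} u \<le> N" unfolding N_def by (intro vdeg_mono) auto
        ultimately show ?thesis using t by (simp add: vdeg_single)
      next
        case False
        then have "vdeg {1..j} u \<le> vdeg {1..j} m" using m j by (force simp: T_def not_less)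
        then show ?thesis by simp
      qed
      moreover have "m + Poly_Mapping.single t N \<in> mons {1..n}" if "m \<in> Poly_Mapping.keys f" for m
        using that f t i by (auto simp: polys_iff)
      ultimately have "f * ?p N \<in> ?I"
        by (auto simp: mult_monomial_in_mon_span dominating_iff_support[OF u])
      then have "?p N \<in> Q" using p by (simp add: Qf mult.commute)
      then have "?p 1 \<in> Q"
      proof (induction N)
        case 0
        then show ?case using one by (simp add: monomial_def)
      next
        case (Suc N)
        have "?p (Suc N) = ?p 1 * ?p N"
          by (simp only: monomial_add[symmetric] single_add[symmetric] plus_1_eq_Suc)
        then have "?p 1 \<in> Q \<or> ?p N \<in> Q"
          using primeideal.I_prime[OF prime p p, of 1 N] Suc.prems by simp
        then show ?case using Suc.IH by blast
      qed
      then show ?thesis by (simp add: X_def)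
    qed
    then show "X ` {1..i} \<subseteq> Q" by auto
  qed
  ultimately show ?thesis using iu by blast
qed

lemma ass_primes_dominating:
  "u \<in> mons {1..n} \<Longrightarrow> ass_primes {1..n} (mon_span (dominating n u)) = prefix_prime n ` Poly_Mapping.keys u"
  using prefix_prime_is_associated associated_prime_is_prefix_prime by blast

lemma dominating_prefix_conditions:
  assumes "u \<in> mons {1..n}"
  shows "dominating n u = {m \<in> mons {1..n}. \<forall>i \<in> Poly_Mapping.keys u. vdeg {1..i} u \<le> vdeg {1..i} m}"
  using dominating_iff_support[OF assms] by auto

lemma intersection_type_dominating:
  fixes I :: "'k::field mpoly set"
  assumes u: "u \<in> mons {1..n}" and I: "I = mon_span (dominating n u)"
  shows "intersection_type {1..n} I"
  unfolding intersection_type_def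
proof (intro conjI exI)
  let ?F = "(\<lambda>P. (P, vdeg (loc_vars {1..n} P) u)) ` prefix_prime n ` Poly_Mapping.keys u"
  have K: "Poly_Mapping.keys u \<subseteq> {1..n}" using u by (simp add: mons_def)
  show "monomial_ideal {1..n} I"
    unfolding I monomial_ideal_iff using upset_dominating by blast
  show "finite ?F" by simp
  show "\<forall>(P, d) \<in> ?F. monomial_prime {1..n} P"
    using K by (auto intro!: monomial_prime_prefix_prime)
  have "I = polys {1..n} \<inter> (\<Inter>P \<in> prefix_prime n ` Poly_Mapping.keys u. ideal_power {1..n} P (vdeg (loc_vars {1..n} P) u))"
    unfolding I dominating_prefix_conditions[OF u] by (rule Inter_prefix_powers[OF K, symmetric])
  then show "I = polys {1..n} \<inter> (\<Inter>(P, d) \<in> ?F. ideal_power {1..n} P d)"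
    by simp
qed

lemma canonical_primary_decomposition_dominating:
  fixes I :: "'k::field mpoly set"
  assumes u: "u \<in> mons {1..n}" and I: "I = mon_span (dominating n u)"
  shows "canonical_primary_decomposition {1..n} I (\<lambda>P. vdeg (loc_vars {1..n} P) u)"
proof -
  have K: "Poly_Mapping.keys u \<subseteq> {1..n}" using u by (simp add: mons_def)
  have "I \<noteq> polys {1..n} \<inter> (\<Inter>P \<in> prefix_prime n ` Poly_Mapping.keys u - {prefix_prime n i}.
          ideal_power {1..n} P (vdeg (loc_vars {1..n} P) u))" if i: "i \<in> Poly_Mapping.keys u" for i
  proof -
    have "prefix_prime n j \<noteq> (prefix_prime n i :: 'k mpoly set)" if "j \<in> Poly_Mapping.keys u - {i}" for j
    proof
      assume "prefix_prime n j = (prefix_prime n i :: 'k mpoly set)"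
      then have "{1..j} = {1..i}"
        using loc_vars_prefix_prime[of j n] loc_vars_prefix_prime[of i n] that i K
        by (metis DiffD1 atLeastAtMost_iff subsetD)
      then have "card {1..j} = card {1..i}" by (rule arg_cong)
      then show False using that by (simp only: card_atLeastAtMost) simp
    qed
    then have drop: "prefix_prime n ` Poly_Mapping.keys u - {prefix_prime n i :: 'k mpoly set} =
        prefix_prime n ` (Poly_Mapping.keys u - {i})" by auto
    obtain w where w: "w \<in> mons {1..n}"
      "\<And>l. l \<le> n \<Longrightarrow> vdeg {1..l} w + (if l = i then 1 else 0) = vdeg {1..l} u"
      using one_step_below[OF u i] by blast
    have "i \<le> n" using i K by auto
    from w(2)[OF this] this have "w \<notin> dominating n u"
      by (auto simp: dominating_def intro!: exI[of _ i])
    moreover have "vdeg {1..j} u \<le> vdeg {1..j} w" if "j \<in> Poly_Mapping.keys u - {i}" for j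
      using w(2)[of j] that K by auto
    then have "w \<in> {m \<in> mons {1..n}. \<forall>j \<in> Poly_Mapping.keys u - {i}. vdeg {1..j} u \<le> vdeg {1..j} m}"
      using w(1) by blast
    ultimately have "dominating n u \<noteq> {m \<in> mons {1..n}. \<forall>j \<in> Poly_Mapping.keys u - {i}. vdeg {1..j} u \<le> vdeg {1..j} m}"
      by blast
    moreover have "Poly_Mapping.keys u - {i} \<subseteq> {1..n}" using K by blast
    ultimately show ?thesis
      unfolding I drop by (simp only: Inter_prefix_powers mon_span_inject not_False_eq_True)
  qed
  moreover have "I = polys {1..n} \<inter> (\<Inter>P \<in> prefix_prime n ` Poly_Mapping.keys u. ideal_power {1..n} P (vdeg (loc_vars {1..n} P) u))"
    unfolding I dominating_prefix_conditions[OF u] by (rule Inter_prefix_powers[OF K, symmetric])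
  moreover have "\<forall>P \<in> prefix_prime n ` Poly_Mapping.keys u. monomial_prime {1..n} P"
    using K by (auto intro!: monomial_prime_prefix_prime)
  ultimately show ?thesis
    unfolding canonical_primary_decomposition_def I ass_primes_dominating[OF u] by blast
qed


section \<open>Monomial localization of a principal Borel ideal\<close>

lemma X_power: "X k ^ a = monomial (Poly_Mapping.single k a)"
proof (induction a)
  case (Suc a)
  then show ?case
    by (simp only: power_Suc X_def monomial_add[symmetric] single_add[symmetric] plus_1_eq_Suc)
qed (simp add: monomial_def)

lemma monomial_sum: "(\<Prod>k \<in> S. monomial (\<phi> k)) = monomial (\<Sum>k \<in> S. \<phi> k)"
  by (induction S rule: infinite_finite_induct) (simp_all add: monomial_add, simp_all add: monomial_def)

lemma localization_hom_prefix_prime: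
  fixes f :: "'k::field mpoly"
  assumes "i \<le> n"
  shows "localization_hom (prefix_prime n i) f =
    (\<Sum>m \<in> Poly_Mapping.keys f. Poly_Mapping.single (expvec i (Poly_Mapping.lookup m)) (Poly_Mapping.lookup f m))"
proof -
  have "(\<Prod>k \<in> Poly_Mapping.keys m. (if X k \<in> (prefix_prime n i :: 'k mpoly set) then X k else 1) ^ Poly_Mapping.lookup m k) =
          (monomial (expvec i (Poly_Mapping.lookup m)) :: 'k mpoly)" for m
  proof -
    have "(if X k \<in> (prefix_prime n i :: 'k mpoly set) then X k else 1) ^ a =
        (monomial (if k \<in> {1..i} then Poly_Mapping.single k a else 0) :: 'k mpoly)" for k a
      by (simp only: X_in_prefix_prime[OF assms] X_power if_distribR if_distrib[of "\<lambda>x. x ^ a"]) (simp add: X_power monomial_def)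
    moreover have "(\<Sum>k \<in> Poly_Mapping.keys m. if k \<in> {1..i} then Poly_Mapping.single k (Poly_Mapping.lookup m k) else 0) =
        expvec i (Poly_Mapping.lookup m)"
    proof (rule poly_mapping_eqI)
      fix k
      have "Poly_Mapping.lookup (if x \<in> {1..i} then Poly_Mapping.single x (Poly_Mapping.lookup m x) else 0) k =
          (if x = k then if k \<in> {1..i} then Poly_Mapping.lookup m k else 0 else 0)" for x
        by (auto simp: lookup_single when_def)
      then show "Poly_Mapping.lookup (\<Sum>k \<in> Poly_Mapping.keys m. if k \<in> {1..i}
            then Poly_Mapping.single k (Poly_Mapping.lookup m k) else 0) k =
          Poly_Mapping.lookup (expvec i (Poly_Mapping.lookup m)) k"
        by (simp only: lookup_sum lookup_expvec) (simp add: sum.delta in_keys_iff)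
    qed
    ultimately show ?thesis by (simp only: monomial_sum)
  qed
  then show ?thesis
    by (simp add: localization_hom_def monomial_def mult_single)
qed

lemma vdeg_expvec:
  assumes "j \<le> i" shows "vdeg {1..j} (expvec i (Poly_Mapping.lookup m)) = vdeg {1..j} m"
  unfolding vdeg_def using assms by (intro sum.cong) (auto simp: lookup_expvec)

lemma vdeg_beyond:
  assumes "m \<in> mons {1..i}" "i \<le> j" shows "vdeg {1..j} m = vdeg {1..i} m"
  unfolding vdeg_def using assms by (intro sum.mono_neutral_right) (auto simp: mons_lookup_zero)

text \<open>
  Setting the variables beyond \<open>i\<close> to 1 truncates exponent vectors and keeps the partial degrees up to
  \<open>i\<close>.  A preimage of \<open>g\<close> is \<open>g\<close> times the part of \<open>u\<close> in the variables beyond \<open>i\<close>.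
\<close>

lemma localization_dominating:
  assumes u: "u \<in> mons {1..n}" and i: "i \<le> n"
  shows "monomial_localization (prefix_prime n i) (mon_span (dominating n u) :: 'k::field mpoly set) =
           mon_span (dominating i (expvec i (Poly_Mapping.lookup u)))"
proof -
  define u' where "u' = expvec i (Poly_Mapping.lookup u)"
  have u': "u' \<in> mons {1..i}" by (simp add: u'_def expvec_in_mons)
  have vu': "vdeg {1..j} u' = vdeg {1..j} u" if "j \<le> i" for j
    using that by (simp add: u'_def vdeg_expvec)
  define w where "w = u - u'"
  have uw: "u = u' + w"
    by (rule poly_mapping_eqI) (simp add: lookup_add lookup_minus w_def u'_def lookup_expvec)
  have w: "w \<in> mons {1..n}" using u by (simp add: w_def mons_diff)
  have w0: "Poly_Mapping.lookup w t = 0" if "t \<in> {1..i}" for t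
    using that by (simp add: w_def lookup_minus u'_def lookup_expvec)
  have "localization_hom (prefix_prime n i) f \<in> mon_span (dominating i u')"
    if f: "f \<in> mon_span (dominating n u)" for f :: "'k mpoly"
    unfolding localization_hom_prefix_prime[OF i]
  proof (rule mon_span_sum)
    fix m assume "m \<in> Poly_Mapping.keys f"
    then have m: "m \<in> dominating n u" using f by (auto simp: mon_span_def)
    then have "expvec i (Poly_Mapping.lookup m) \<in> dominating i u'"
      using i by (auto simp: dominating_def vu' vdeg_expvec expvec_in_mons)
    then show "Poly_Mapping.single (expvec i (Poly_Mapping.lookup m)) (Poly_Mapping.lookup f m) \<in> mon_span (dominating i u')"
      by (simp add: single_in_mon_span)
  qed
  moreover have "g \<in> localization_hom (prefix_prime n i) ` mon_span (dominating n u)"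
    if g: "g \<in> mon_span (dominating i u')" for g :: "'k mpoly"
  proof
    have gm: "m \<in> mons {1..i}" "\<And>j. j \<le> i \<Longrightarrow> vdeg {1..j} u \<le> vdeg {1..j} m"
      if "m \<in> Poly_Mapping.keys g" for m
      using g that by (auto simp: mon_span_def dominating_def vu')
    show "g * monomial w \<in> mon_span (dominating n u)"
      unfolding mult_monomial_in_mon_span
    proof
      fix m assume m: "m \<in> Poly_Mapping.keys g"
      have "vdeg {1..j} u \<le> vdeg {1..j} (m + w)" for j
      proof (cases "j \<le> i")
        case True
        then show ?thesis using gm(2)[OF m True] by simp
      next
        case False
        then have "vdeg {1..j} u = vdeg {1..i} u + vdeg {1..j} w"
          using vdeg_beyond[OF u', of j] vu'[of i] arg_cong[OF uw, of "vdeg {1..j}"] by simp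
        then show ?thesis
          using gm(2)[OF m order_refl] vdeg_beyond[OF gm(1)[OF m], of j] False by simp
      qed
      moreover have "m \<in> mons {1..n}" using gm(1)[OF m] mons_mono[of "{1..i}" "{1..n}"] i by auto
      ultimately show "m + w \<in> dominating n u" using w by (simp add: dominating_def)
    qed
    have "expvec i (Poly_Mapping.lookup (m + w)) = m" if "m \<in> Poly_Mapping.keys g" for m
      using gm(1)[OF that] by (intro mons_eqI[OF expvec_in_mons]) (auto simp: lookup_expvec lookup_add w0)
    then have "localization_hom (prefix_prime n i) (g * monomial w) =
        (\<Sum>m \<in> Poly_Mapping.keys g. Poly_Mapping.single m (Poly_Mapping.lookup g m))"
      unfolding localization_hom_prefix_prime[OF i] keys_mult_monomial
      by (subst sum.reindex) (auto simp: inj_on_def lookup_mult_monomial)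
    then show "g = localization_hom (prefix_prime n i) (g * monomial w)"
      using mpoly_expand[of g] by simp
  qed
  ultimately show ?thesis unfolding monomial_localization_def u'_def by blast
qed

section \<open>Homogeneous polynomials and splitting by the smallest variable\<close>

lemma mdeg_add: "mdeg (m + w) = mdeg m + mdeg w"
proof -
  let ?K = "Poly_Mapping.keys m \<union> Poly_Mapping.keys w"
  have "mdeg x = vdeg ?K x" if "Poly_Mapping.keys x \<subseteq> ?K" for x
    using that by (intro mdeg_eq_vdeg) (auto simp: mons_def)
  then show ?thesis by (simp add: keys_plus_nat)
qed

lemma mdeg_single: "mdeg (Poly_Mapping.single i a) = a"
  by (simp add: mdeg_def)

lemma homogeneous_iff: "homogeneous e f \<longleftrightarrow> f \<in> mon_span {m. int (mdeg m) = e}"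
  by (auto simp: homogeneous_def mon_span_def)

lemma homogeneous_zero [simp]: "homogeneous e 0"
  by (simp add: homogeneous_iff)

lemma homogeneous_X [simp]: "homogeneous 1 (X i)"
  by (simp add: homogeneous_iff X_def mdeg_single)

lemma homogeneous_mult:
  "homogeneous a f \<Longrightarrow> homogeneous b g \<Longrightarrow> a + b = e \<Longrightarrow> homogeneous e (f * g)"
  unfolding homogeneous_iff by (erule (1) mon_span_mult) (auto simp: mdeg_add)

lemma homogeneous_sum: "(\<And>i. i \<in> A \<Longrightarrow> homogeneous e (f i)) \<Longrightarrow> homogeneous e (sum f A)"
  unfolding homogeneous_iff by (rule mon_span_sum)

lemma homogeneous_diff: "homogeneous e f \<Longrightarrow> homogeneous e g \<Longrightarrow> homogeneous e (f - g)"
  unfolding homogeneous_iff by (rule mon_span_diff)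

lemma homogeneous_uminus: "homogeneous e f \<Longrightarrow> homogeneous e (- f)"
  unfolding homogeneous_iff by (rule mon_span_uminus)

lemma polys_zero [simp]: "0 \<in> polys V"
  by (simp add: polys_iff)

lemma polys_X [simp]: "i \<in> V \<Longrightarrow> X i \<in> polys V"
  by (simp add: X_def)

lemma polys_mult: "f \<in> polys V \<Longrightarrow> g \<in> polys V \<Longrightarrow> f * g \<in> polys V"
  unfolding polys_eq_mon_span by (erule (1) mon_span_mult) simp

lemma polys_sum: "(\<And>i. i \<in> A \<Longrightarrow> f i \<in> polys V) \<Longrightarrow> sum f A \<in> polys V"
  unfolding polys_eq_mon_span by (rule mon_span_sum)

lemma polys_diff: "f \<in> polys V \<Longrightarrow> g \<in> polys V \<Longrightarrow> f - g \<in> polys V"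
  unfolding polys_eq_mon_span by (rule mon_span_diff)

lemma polys_uminus: "f \<in> polys V \<Longrightarrow> - f \<in> polys V"
  unfolding polys_eq_mon_span by (rule mon_span_uminus)

lemma polys_mono: "V \<subseteq> W \<Longrightarrow> f \<in> polys V \<Longrightarrow> f \<in> polys W"
  by (auto simp: polys_iff dest: mons_mono)

lemma split_one_variable:
  fixes f :: "'k::field mpoly"
  assumes f: "f \<in> polys {a..N}"
  obtains w f' where "w \<in> polys {a..N}" "f' \<in> polys {Suc a..N}" "f = X a * w + f'"
    "\<And>e. homogeneous (e + 1) f \<Longrightarrow> homogeneous e w \<and> homogeneous (e + 1) f'"
proof -
  let ?S = "{m \<in> Poly_Mapping.keys f. Poly_Mapping.lookup m a \<noteq> 0}"
  let ?T = "{m \<in> Poly_Mapping.keys f. Poly_Mapping.lookup m a = 0}"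
  define w where "w = (\<Sum>m \<in> ?S. Poly_Mapping.single (m - Poly_Mapping.single a 1) (Poly_Mapping.lookup f m))"
  define f' where "f' = (\<Sum>m \<in> ?T. Poly_Mapping.single m (Poly_Mapping.lookup f m))"
  have m: "m \<in> mons {a..N}" if "m \<in> Poly_Mapping.keys f" for m
    using f that by (auto simp: polys_iff)
  have split: "Poly_Mapping.single a 1 + (m - Poly_Mapping.single a 1) = m" if "m \<in> ?S" for m
    using that by (intro single_plus_diff) auto
  have "X a * w = (\<Sum>m \<in> ?S. Poly_Mapping.single m (Poly_Mapping.lookup f m))"
    unfolding w_def sum_distrib_left X_def monomial_def mult_single
    by (rule sum.cong) (auto simp: split)
  moreover have "f = (\<Sum>m \<in> ?S \<union> ?T. Poly_Mapping.single m (Poly_Mapping.lookup f m))"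
    by (subst mpoly_expand) (rule sum.cong, auto)
  moreover have "\<dots> = (\<Sum>m \<in> ?S. Poly_Mapping.single m (Poly_Mapping.lookup f m)) + f'"
    unfolding f'_def by (rule sum.union_disjoint) auto
  ultimately have "f = X a * w + f'" by simp
  moreover have "w \<in> polys {a..N}"
    unfolding w_def polys_eq_mon_span
    by (rule mon_span_sum) (auto simp: single_in_mon_span intro: m mons_diff)
  moreover have "f' \<in> polys {Suc a..N}"
    unfolding f'_def polys_eq_mon_span
  proof (rule mon_span_sum)
    fix x assume x: "x \<in> ?T"
    have "t \<in> {Suc a..N}" if "t \<in> Poly_Mapping.keys x" for t
    proof -
      have "t \<in> {a..N}" using x m[of x] that by (auto simp: mons_def)
      moreover have "t \<noteq> a" using x that by (auto simp: in_keys_iff)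
      ultimately show ?thesis by auto
    qed
    then show "Poly_Mapping.single x (Poly_Mapping.lookup f x) \<in> mon_span (mons {Suc a..N})"
      by (auto simp: single_in_mon_span mons_def)
  qed
  moreover have "homogeneous e w \<and> homogeneous (e + 1) f'" if "homogeneous (e + 1) f" for e
  proof
    show "homogeneous e w"
      unfolding homogeneous_iff w_def
    proof (rule mon_span_sum)
      fix x assume x: "x \<in> ?S"
      then have "int (mdeg x) = e + 1" using that by (auto simp: homogeneous_def)
      moreover have "mdeg x = 1 + mdeg (x - Poly_Mapping.single a 1)"
        using arg_cong[OF split[OF x], of mdeg] by (simp add: mdeg_add mdeg_single)
      ultimately show "Poly_Mapping.single (x - Poly_Mapping.single a 1) (Poly_Mapping.lookup f x)
          \<in> mon_span {m. int (mdeg m) = e}"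
        by (simp add: single_in_mon_span)
    qed
    show "homogeneous (e + 1) f'"
      unfolding homogeneous_iff f'_def
      by (rule mon_span_sum) (use that in \<open>auto simp: single_in_mon_span homogeneous_def\<close>)
  qed
  ultimately show thesis using that[of w f'] by blast
qed

text \<open>
  Sorting the monomials by their smallest variable decomposes \<open>K[x\<^sub>1, \<dots>, x\<^sub>N]\<close> into \<open>K[x\<^sub>c, \<dots>, x\<^sub>N]\<close> and the
  spaces \<open>x\<^sub>i K[x\<^sub>i, \<dots>, x\<^sub>N]\<close> for \<open>i < c\<close>; the next lemma is the directness of this sum.
\<close>

lemma split_by_smallest_variable:
  fixes f :: "'k::field mpoly"
  assumes f: "f \<in> polys {1..N}" and "1 \<le> c"
  shows "\<exists>w f0. f0 \<in> polys {c..N} \<and> (\<forall>i \<in> {1..<c}. w i \<in> polys {i..N}) \<and>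
           f = (\<Sum>i \<in> {1..<c}. X i * w i) + f0 \<and>
           (\<forall>e. homogeneous (e + 1) f \<longrightarrow> homogeneous (e + 1) f0 \<and> (\<forall>i \<in> {1..<c}. homogeneous e (w i)))"
  using assms(2)
proof (induction c rule: dec_induct)
  case base
  show ?case using f by (intro exI[of _ "\<lambda>_. 0"] exI[of _ f]) simp
next
  case (step c)
  then obtain w f0 where w: "f0 \<in> polys {c..N}" "\<forall>i \<in> {1..<c}. w i \<in> polys {i..N}"
    "f = (\<Sum>i \<in> {1..<c}. X i * w i) + f0"
    "\<forall>e. homogeneous (e + 1) f \<longrightarrow> homogeneous (e + 1) f0 \<and> (\<forall>i \<in> {1..<c}. homogeneous e (w i))"
    by blast
  obtain v f1 where v: "v \<in> polys {c..N}" "f1 \<in> polys {Suc c..N}" "f0 = X c * v + f1"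
    "\<And>e. homogeneous (e + 1) f0 \<Longrightarrow> homogeneous e v \<and> homogeneous (e + 1) f1"
    using split_one_variable[OF w(1)] by metis
  have ins: "{1..<Suc c} = insert c {1..<c}" using step.hyps by auto
  have "(\<Sum>i \<in> {1..<c}. X i * (w(c := v)) i) = (\<Sum>i \<in> {1..<c}. X i * w i)"
    by (rule sum.cong) auto
  then have "f = (\<Sum>i \<in> {1..<Suc c}. X i * (w(c := v)) i) + f1"
    unfolding ins using w(3) v(3) by (simp add: algebra_simps)
  then show ?case
    using w(2,4) v(1,2,4) by (intro exI[of _ "w(c := v)"] exI[of _ f1]) (auto simp: ins)
qed

lemma smallest_variable_independent:
  fixes w :: "nat \<Rightarrow> 'k::field mpoly"
  assumes w: "\<And>i. i \<in> {1..<c} \<Longrightarrow> w i \<in> polys {i..N}"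
    and zero: "(\<Sum>i \<in> {1..<c}. X i * w i) = 0" and i: "i \<in> {1..<c}"
  shows "w i = 0"
  using i
proof (induction i rule: less_induct)
  case (less i)
  have "Poly_Mapping.lookup (w i) m = 0" for m
  proof -
    let ?x = "m + Poly_Mapping.single i 1"
    have "Poly_Mapping.lookup (X j * w j) ?x = 0" if j: "j \<in> {1..<c} - {i}" for j
    proof (cases "j < i")
      case True
      then show ?thesis using less.IH[OF True] j by simp
    next
      case False
      have "?x \<notin> Poly_Mapping.keys (w j * X j)"
      proof
        assume "?x \<in> Poly_Mapping.keys (w j * X j)"
        then obtain m' where m': "m' \<in> Poly_Mapping.keys (w j)" "?x = m' + Poly_Mapping.single j 1"
          by (auto simp: X_def keys_mult_monomial)
        have "m' \<in> mons {j..N}" using m'(1) w[of j] j by (auto simp: polys_iff)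
        then have "Poly_Mapping.lookup m' i = 0" using False j by (intro mons_lookup_zero) auto
        then show False
          using arg_cong[OF m'(2), of "\<lambda>p. Poly_Mapping.lookup p i"] j
          by (simp add: lookup_add lookup_single when_def)
      qed
      then show ?thesis by (simp add: in_keys_iff mult.commute)
    qed
    then have "(\<Sum>j \<in> {1..<c} - {i}. Poly_Mapping.lookup (X j * w j) ?x) = 0"
      by (intro sum.neutral) blast
    moreover have "(\<Sum>j \<in> {1..<c}. Poly_Mapping.lookup (X j * w j) ?x) = 0"
      using zero by (simp flip: lookup_sum)
    ultimately have "Poly_Mapping.lookup (X i * w i) ?x = 0"
      using less.prems by (simp add: sum.remove)
    then show ?thesis
      by (simp add: X_def mult.commute[of "monomial _"] lookup_mult_monomial)
  qed
  then show ?case by (intro poly_mapping_eqI) simp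
qed

lemma polys_tail: "f \<in> polys {i..N} \<Longrightarrow> 1 \<le> i \<Longrightarrow> f \<in> polys {1..N}"
  by (erule polys_mono[rotated]) simp

section \<open>Triangular involutive bases and their syzygies\<close>

text \<open>
  The vectors \<open>g k\<close> for \<open>k < b\<close> are elements of a free module of rank \<open>r\<close>.  The second clause says that
  the spaces \<open>K[x\<^sub>c, \<dots>, x\<^sub>N] g\<close>, with \<open>c\<close> the class of the generator \<open>g\<close>, form a direct sum.  The third
  clause says that multiplying a generator by a variable below its class leads into the span of the
  preceding generators, with linear coefficients of the allowed kind; so this sum of spaces is a
  submodule.  The triangularity, with only preceding generators on the right hand side, makes every
  rewriting process terminate.
\<close>

definition involutive_basis ::
  "nat \<Rightarrow> nat \<Rightarrow> nat \<Rightarrow> (nat \<Rightarrow> nat) \<Rightarrow> (nat \<Rightarrow> nat \<Rightarrow> 'k::field mpoly) \<Rightarrow> bool" where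
  "involutive_basis N r b c g \<longleftrightarrow>
     (\<forall>k<b. g k \<in> free_mod {1..N} r \<and> 1 \<le> c k \<and> c k \<le> Suc N) \<and>
     (\<forall>h. (\<forall>k<b. h k \<in> polys {c k..N}) \<and> (\<forall>l. (\<Sum>k<b. h k * g k l) = 0) \<longrightarrow> (\<forall>k<b. h k = 0)) \<and>
     (\<forall>k<b. \<forall>i \<in> {1..<c k}. \<exists>f. (\<forall>j<k. f j \<in> polys {c j..N} \<and> homogeneous 1 (f j)) \<and>
        (\<forall>l. X i * g k l = (\<Sum>j<k. f j * g j l)))"

definition syzygies :: "nat \<Rightarrow> nat \<Rightarrow> (nat \<Rightarrow> nat \<Rightarrow> 'k::field mpoly) \<Rightarrow> (nat \<Rightarrow> 'k mpoly) set" where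
  "syzygies N b g = {v \<in> free_mod {1..N} b. \<forall>l. (\<Sum>k<b. v k * g k l) = 0}"

text \<open>
  Fixing the rewriting coefficients \<open>f\<close> makes the syzygies explicit, one for each rewriting rule.
\<close>

locale involutive =
  fixes N r b :: nat and c :: "nat \<Rightarrow> nat" and g :: "nat \<Rightarrow> nat \<Rightarrow> 'k::field mpoly"
    and f :: "nat \<Rightarrow> nat \<Rightarrow> nat \<Rightarrow> 'k mpoly"
  assumes class_bounds: "k < b \<Longrightarrow> 1 \<le> c k \<and> c k \<le> Suc N"
    and independent: "(\<And>k. k < b \<Longrightarrow> h k \<in> polys {c k..N}) \<Longrightarrow> (\<And>l. (\<Sum>k<b. h k * g k l) = 0) \<Longrightarrow>
          k < b \<Longrightarrow> h k = 0"
    and coeff: "k < b \<Longrightarrow> i \<in> {1..<c k} \<Longrightarrow> j < k \<Longrightarrow> f k i j \<in> polys {c j..N} \<and> homogeneous 1 (f k i j)"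
    and rewriting: "k < b \<Longrightarrow> i \<in> {1..<c k} \<Longrightarrow> X i * g k l = (\<Sum>j<k. f k i j * g j l)"
begin

definition syz :: "nat \<Rightarrow> nat \<Rightarrow> nat \<Rightarrow> 'k mpoly" where
  "syz k i l = (if l = k then X i else if l < k then - f k i l else 0)"

lemma coeff_polys:
  assumes "k < b" "i \<in> {1..<c k}" "j < k" shows "f k i j \<in> polys {1..N}"
proof -
  have "1 \<le> c j" using class_bounds[of j] assms by simp
  then show ?thesis using coeff[OF assms] polys_tail by blast
qed

lemma syz_polys:
  assumes "k < b" "i \<in> {1..<c k}" shows "syz k i l \<in> polys {1..N}"
  using assms class_bounds[of k] by (auto simp: syz_def intro!: polys_uminus coeff_polys polys_X)

lemma syz_free_mod:
  assumes "k < b" "i \<in> {1..<c k}" shows "syz k i \<in> free_mod {1..N} b"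
  using syz_polys[OF assms] assms by (auto simp: free_mod_def syz_def)

lemma syz_homogeneous:
  assumes "k < b" "i \<in> {1..<c k}" shows "homogeneous 1 (syz k i l)"
  using assms coeff by (auto simp: syz_def intro!: homogeneous_uminus)

lemma syz_combination:
  assumes "k < b"
  shows "(\<Sum>l<b. syz k i l * G l) = X i * G k - (\<Sum>j<k. f k i j * G j)"
proof -
  have "(\<Sum>l<b. syz k i l * G l) = (\<Sum>l<Suc k. syz k i l * G l)"
    using assms by (intro sum.mono_neutral_right) (auto simp: syz_def)
  also have "\<dots> = X i * G k + (\<Sum>l<k. - (f k i l * G l))"
    by (simp add: syz_def)
  finally show ?thesis by (simp add: sum_negf)
qed

lemma syz_is_syzygy:
  assumes "k < b" "i \<in> {1..<c k}" shows "(\<Sum>j<b. syz k i j * g j l) = 0"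
  using syz_combination[OF assms(1), of i "\<lambda>j. g j l"] rewriting[OF assms] by simp

text \<open>
  Reduction modulo the syzygies \<open>x\<^sub>i e\<^sub>k - \<Sum>\<^sub>j f\<^sub>k\<^sub>i\<^sub>j e\<^sub>j\<close> with \<open>i < c k\<close>: the last component is split by smallest
  variables, and the parts divisible by some \<open>x\<^sub>i\<close> are subtracted as multiples of the corresponding
  syzygies.  By triangularity this changes only earlier components, which allows induction on the
  number \<open>K\<close> of components in use.  If \<open>z\<close> is homogeneous, the coefficients are so as well, of one degree less.
\<close>

lemma normal_form:
  assumes "K \<le> b" "\<And>k. z k \<in> polys {1..N}" "\<And>k. K \<le> k \<Longrightarrow> z k = 0"
  shows "\<exists>w. (\<forall>k<K. \<forall>i \<in> {1..<c k}. w k i \<in> polys {i..N}) \<and>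
           (\<forall>l<K. z l - (\<Sum>k<K. \<Sum>i \<in> {1..<c k}. w k i * syz k i l) \<in> polys {c l..N}) \<and>
           (\<forall>e. (\<forall>k. homogeneous (e + 1) (z k)) \<longrightarrow> (\<forall>k<K. \<forall>i \<in> {1..<c k}. homogeneous e (w k i)))"
  using assms
proof (induction K arbitrary: z)
  case 0
  then show ?case by simp
next
  case (Suc K)
  have K: "K < b" using Suc.prems(1) by simp
  obtain v f0 where v: "f0 \<in> polys {c K..N}" "\<forall>i \<in> {1..<c K}. v i \<in> polys {i..N}"
    "z K = (\<Sum>i \<in> {1..<c K}. X i * v i) + f0"
    "\<forall>e. homogeneous (e + 1) (z K) \<longrightarrow> homogeneous (e + 1) f0 \<and> (\<forall>i \<in> {1..<c K}. homogeneous e (v i))"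
    using split_by_smallest_variable[OF Suc.prems(2)[of K], of "c K"] class_bounds[OF K] by blast
  define z' where "z' = (\<lambda>l. if l < K then z l - (\<Sum>i \<in> {1..<c K}. v i * syz K i l) else 0)"
  have vp: "v i \<in> polys {1..N}" if "i \<in> {1..<c K}" for i
    using v(2) that polys_tail by (metis atLeastLessThan_iff)
  have z'p: "z' l \<in> polys {1..N}" for l
    using Suc.prems(2) K vp by (auto simp: z'_def intro!: polys_diff polys_sum polys_mult syz_polys)
  have z'h: "homogeneous (e + 1) (z' l)" if "\<forall>k. homogeneous (e + 1) (z k)" for e l
    using that v(4) K
    by (auto simp: z'_def intro!: homogeneous_diff homogeneous_sum homogeneous_mult[where a = e and b = 1] syz_homogeneous)
  obtain w where w: "\<forall>k<K. \<forall>i \<in> {1..<c k}. w k i \<in> polys {i..N}"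
    "\<forall>l<K. z' l - (\<Sum>k<K. \<Sum>i \<in> {1..<c k}. w k i * syz k i l) \<in> polys {c l..N}"
    "\<forall>e. (\<forall>k. homogeneous (e + 1) (z' k)) \<longrightarrow> (\<forall>k<K. \<forall>i \<in> {1..<c k}. homogeneous e (w k i))"
    using Suc.IH[of z'] K z'p by (auto simp: z'_def)
  have sum_eq: "(\<Sum>k<Suc K. \<Sum>i \<in> {1..<c k}. (w(K := v)) k i * syz k i l) =
      (\<Sum>k<K. \<Sum>i \<in> {1..<c k}. w k i * syz k i l) + (\<Sum>i \<in> {1..<c K}. v i * syz K i l)" for l
    by simp
  have "z l - (\<Sum>k<Suc K. \<Sum>i \<in> {1..<c k}. (w(K := v)) k i * syz k i l) \<in> polys {c l..N}"
    if l: "l < Suc K" for l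
  proof (cases "l = K")
    case True
    have "(\<Sum>k<K. \<Sum>i \<in> {1..<c k}. w k i * syz k i K) = 0"
      by (intro sum.neutral) (auto simp: syz_def)
    moreover have "(\<Sum>i \<in> {1..<c K}. v i * syz K i K) = (\<Sum>i \<in> {1..<c K}. X i * v i)"
      by (simp add: syz_def mult.commute)
    ultimately show ?thesis unfolding sum_eq True using v(1,3) by simp
  next
    case False
    then have "l < K" using l by simp
    then show ?thesis using w(2) unfolding sum_eq by (auto simp: z'_def algebra_simps)
  qed
  moreover have "\<forall>k<Suc K. \<forall>i \<in> {1..<c k}. (w(K := v)) k i \<in> polys {i..N}"
    using w(1) v(2) by (auto simp: less_Suc_eq)
  moreover have "\<forall>e. (\<forall>k. homogeneous (e + 1) (z k)) \<longrightarrow>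
      (\<forall>k<Suc K. \<forall>i \<in> {1..<c k}. homogeneous e ((w(K := v)) k i))"
    using w(3) v(4) z'h by (auto simp: less_Suc_eq)
  ultimately show ?case by blast
qed

text \<open>
  The normal form of a syzygy is a syzygy whose components are all of the allowed kind, hence zero by
  independence.
\<close>

lemma syzygy_representation:
  assumes "K \<le> b" "\<And>k. z k \<in> polys {1..N}" "\<And>k. K \<le> k \<Longrightarrow> z k = 0"
    and syzygy: "\<And>l. (\<Sum>k<b. z k * g k l) = 0"
  shows "\<exists>w. (\<forall>k<K. \<forall>i \<in> {1..<c k}. w k i \<in> polys {i..N}) \<and>
           (\<forall>l. z l = (\<Sum>k<K. \<Sum>i \<in> {1..<c k}. w k i * syz k i l)) \<and>
           (\<forall>e. (\<forall>k. homogeneous (e + 1) (z k)) \<longrightarrow> (\<forall>k<K. \<forall>i \<in> {1..<c k}. homogeneous e (w k i)))"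
proof -
  obtain w where w: "\<forall>k<K. \<forall>i \<in> {1..<c k}. w k i \<in> polys {i..N}"
    "\<forall>l<K. z l - (\<Sum>k<K. \<Sum>i \<in> {1..<c k}. w k i * syz k i l) \<in> polys {c l..N}"
    "\<forall>e. (\<forall>k. homogeneous (e + 1) (z k)) \<longrightarrow> (\<forall>k<K. \<forall>i \<in> {1..<c k}. homogeneous e (w k i))"
    using normal_form[of K z] assms by blast
  let ?s = "\<lambda>l. \<Sum>k<K. \<Sum>i \<in> {1..<c k}. w k i * syz k i l"
  let ?y = "\<lambda>l. z l - ?s l"
  have big: "?y l = 0" if "K \<le> l" for l
    using assms(3)[OF that] that by (auto simp: syz_def intro!: sum.neutral)
  have "(\<Sum>l<b. ?s l * g l q) = (\<Sum>k<K. \<Sum>i \<in> {1..<c k}. w k i * (\<Sum>l<b. syz k i l * g l q))" for q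
  proof -
    have "(\<Sum>l<b. ?s l * g l q) = (\<Sum>l<b. \<Sum>k<K. \<Sum>i \<in> {1..<c k}. w k i * (syz k i l * g l q))"
      by (simp add: sum_distrib_right mult.assoc)
    also have "\<dots> = (\<Sum>k<K. \<Sum>l<b. \<Sum>i \<in> {1..<c k}. w k i * (syz k i l * g l q))"
      by (rule sum.swap)
    also have "\<dots> = (\<Sum>k<K. \<Sum>i \<in> {1..<c k}. \<Sum>l<b. w k i * (syz k i l * g l q))"
      by (intro sum.cong refl sum.swap)
    finally show ?thesis by (simp add: sum_distrib_left)
  qed
  also have "\<dots> q = 0" for q
    using assms(1) by (intro sum.neutral) (auto simp: syz_is_syzygy)
  finally have "(\<Sum>l<b. ?s l * g l q) = 0" for q .
  then have "(\<Sum>l<b. ?y l * g l q) = 0" for q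
    using syzygy by (simp add: left_diff_distrib sum_subtractf)
  moreover have "?y l \<in> polys {c l..N}" if "l < b" for l
    using w(2) big by (cases "l < K") auto
  ultimately have "?y l = 0" if "l < b" for l
    using independent[of ?y l] that by blast
  then have "z l = ?s l" for l
    using big[of l] assms(1) by (cases "l < b") auto
  then show ?thesis using w(1,3) by blast
qed

text \<open>
  The last component with a nonzero coefficient receives only the terms \<open>x\<^sub>i h\<^sub>k\<^sub>i\<close>, and these are independent
  because \<open>x\<^sub>i\<close> is their smallest variable.
\<close>

lemma syz_independent:
  assumes h: "\<And>k i. k < b \<Longrightarrow> i \<in> {1..<c k} \<Longrightarrow> h k i \<in> polys {i..N}"
    and zero: "\<And>l. (\<Sum>k<b. \<Sum>i \<in> {1..<c k}. h k i * syz k i l) = 0"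
    and k: "k < b" "i \<in> {1..<c k}"
  shows "h k i = 0"
proof -
  have "k < b \<Longrightarrow> \<forall>i \<in> {1..<c k}. h k i = 0" for k
  proof (induction "b - k" arbitrary: k rule: less_induct)
    case less
    have "(\<Sum>i \<in> {1..<c k'}. h k' i * syz k' i k) = 0" if "k' \<in> {..<b} - {k}" for k'
    proof (cases "k' < k")
      case True
      then show ?thesis by (intro sum.neutral) (auto simp: syz_def)
    next
      case False
      then have "\<forall>i \<in> {1..<c k'}. h k' i = 0" using that by (intro less.hyps) auto
      then show ?thesis by (intro sum.neutral) auto
    qed
    then have "(\<Sum>k' \<in> {..<b} - {k}. \<Sum>i \<in> {1..<c k'}. h k' i * syz k' i k) = 0"
      by (intro sum.neutral) blast
    then have "(\<Sum>i \<in> {1..<c k}. h k i * syz k i k) = 0"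
      using zero[of k] less.prems by (simp add: sum.remove[of "{..<b}" k])
    then have "(\<Sum>i \<in> {1..<c k}. X i * h k i) = 0"
      by (simp add: syz_def mult.commute)
    then show ?case
      using smallest_variable_independent[of "c k" "h k" N] h less.prems by blast
  qed
  then show ?thesis using k by blast
qed

text \<open>
  The syzygy with leading term \<open>x\<^sub>i e\<^sub>k\<close> gets class \<open>i\<close>.  For \<open>j < i\<close> the products \<open>x\<^sub>j s\<^sub>k\<^sub>i\<close> and \<open>x\<^sub>i s\<^sub>k\<^sub>j\<close> have the same
  leading term, and \<open>x\<^sub>i\<close> is an allowed coefficient for \<open>s\<^sub>k\<^sub>j\<close>.  Their difference is a syzygy supported before
  \<open>k\<close>, quadratic in its entries, and so a linear combination of earlier syzygies.  The new basis is
  triangular for the lexicographic order of the pairs \<open>(k, i)\<close>.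
\<close>

lemma syz_rewriting:
  assumes k: "k < b" "i \<in> {1..<c k}" and j: "j \<in> {1..<i}"
  shows "\<exists>F. (\<forall>k'<b. \<forall>i' \<in> {1..<c k'}. F k' i' \<in> polys {i'..N} \<and> homogeneous 1 (F k' i') \<and>
              (F k' i' \<noteq> 0 \<longrightarrow> k' < k \<or> k' = k \<and> i' < i)) \<and>
             (\<forall>l. X j * syz k i l = (\<Sum>k'<b. \<Sum>i' \<in> {1..<c k'}. F k' i' * syz k' i' l))"
proof -
  have j': "j \<in> {1..<c k}" using k j by auto
  have N: "j \<le> N" "i \<le> N" using class_bounds[OF k(1)] k j by auto
  define z where "z = (\<lambda>l. X j * syz k i l - X i * syz k j l)"
  have z_poly: "z l \<in> polys {1..N}" for l
    unfolding z_def using k j j' N by (intro polys_diff polys_mult syz_polys polys_X) auto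
  have z_supp: "z l = 0" if "k \<le> l" for l
    using that by (auto simp: z_def syz_def mult.commute)
  have z_syz: "(\<Sum>l<b. z l * g l q) = 0" for q
  proof -
    have "(\<Sum>l<b. z l * g l q) = X j * (\<Sum>l<b. syz k i l * g l q) - X i * (\<Sum>l<b. syz k j l * g l q)"
      by (simp add: z_def sum_distrib_left left_diff_distrib sum_subtractf mult.assoc)
    then show ?thesis using syz_is_syzygy k j' by simp
  qed
  obtain w where w: "\<forall>k'<k. \<forall>i' \<in> {1..<c k'}. w k' i' \<in> polys {i'..N}"
    "\<forall>l. z l = (\<Sum>k'<k. \<Sum>i' \<in> {1..<c k'}. w k' i' * syz k' i' l)"
    "\<forall>e. (\<forall>l. homogeneous (e + 1) (z l)) \<longrightarrow> (\<forall>k'<k. \<forall>i' \<in> {1..<c k'}. homogeneous e (w k' i'))"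
    using syzygy_representation[OF less_imp_le[OF k(1)] z_poly z_supp z_syz] by blast
  have "homogeneous (1 + 1) (z l)" for l
    unfolding z_def
    using k j' by (intro homogeneous_diff homogeneous_mult[where a = 1 and b = 1] syz_homogeneous) auto
  then have wh: "\<forall>k'<k. \<forall>i' \<in> {1..<c k'}. homogeneous 1 (w k' i')" using w(3) by blast
  define F where "F = (\<lambda>k' i'. if k' < k then w k' i' else if k' = k \<and> i' = j then X i else 0)"
  have "X j * syz k i l = (\<Sum>k'<b. \<Sum>i' \<in> {1..<c k'}. F k' i' * syz k' i' l)" for l
  proof -
    have "(\<Sum>k'<b. \<Sum>i' \<in> {1..<c k'}. F k' i' * syz k' i' l) =
        (\<Sum>k'<Suc k. \<Sum>i' \<in> {1..<c k'}. F k' i' * syz k' i' l)"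
      using k(1) by (intro sum.mono_neutral_right) (auto simp: F_def intro!: sum.neutral)
    also have "\<dots> = z l + (\<Sum>i' \<in> {1..<c k}. F k i' * syz k i' l)"
      using w(2) by (simp add: F_def)
    also have "(\<Sum>i' \<in> {1..<c k}. F k i' * syz k i' l) = (\<Sum>i' \<in> {1..<c k}. if i' = j then X i * syz k j l else 0)"
      by (intro sum.cong) (auto simp: F_def)
    also have "\<dots> = X i * syz k j l" using j' by simp
    finally show ?thesis by (simp add: z_def)
  qed
  moreover have "F k' i' \<in> polys {i'..N} \<and> homogeneous 1 (F k' i') \<and>
      (F k' i' \<noteq> 0 \<longrightarrow> k' < k \<or> k' = k \<and> i' < i)" if "k' < b" "i' \<in> {1..<c k'}" for k' i'
    using that w(1) wh j N by (auto simp: F_def)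
  ultimately show ?thesis by blast
qed

end

lemma enumerate_by_key:
  fixes \<kappa> :: "'a \<Rightarrow> 'b::linorder"
  assumes "finite P"
  obtains e where "bij_betw e {..<card P} P"
    "\<And>p q. p < card P \<Longrightarrow> q < card P \<Longrightarrow> \<kappa> (e p) < \<kappa> (e q) \<Longrightarrow> p < q"
proof -
  obtain ys where ys: "set ys = P" "distinct ys" using finite_distinct_list[OF assms] by blast
  define xs where "xs = sort_key \<kappa> ys"
  have xs: "set xs = P" "distinct xs" "length xs = card P" "sorted (map \<kappa> xs)"
    using ys by (auto simp: xs_def distinct_card)
  show thesis
  proof
    show "bij_betw ((!) xs) {..<card P} P" using xs bij_betw_nth by metis
    fix p q assume pq: "p < card P" "q < card P" "\<kappa> (xs ! p) < \<kappa> (xs ! q)"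
    show "p < q"
    proof (rule ccontr)
      assume "\<not> p < q"
      then have "map \<kappa> xs ! q \<le> map \<kappa> xs ! p"
        using pq xs by (intro sorted_nth_mono) auto
      then show False using pq xs by simp
    qed
  qed
qed

text \<open>
  The basis consists of the syzygies \<open>syz k i\<close> with \<open>k < b\<close> and \<open>i < c k\<close>.  The pairs \<open>(k, i)\<close> are numbered
  along the key \<open>k (N + 1) + i\<close>, which is lexicographic since \<open>i \<le> N\<close>.
\<close>

theorem syzygies_have_involutive_basis:
  fixes g :: "nat \<Rightarrow> nat \<Rightarrow> 'k::field mpoly"
  assumes "involutive_basis N r b c g"
  shows "\<exists>b' c' s. involutive_basis N b b' c' s \<and> (\<forall>q<b'. \<forall>l. homogeneous 1 (s q l)) \<and>
           syzygies N b g = (\<lambda>w l. \<Sum>q<b'. w q * s q l) ` free_mod {1..N} b'"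
proof -
  have "\<forall>k i. \<exists>f. k < b \<and> i \<in> {1..<c k} \<longrightarrow> (\<forall>j<k. f j \<in> polys {c j..N} \<and> homogeneous 1 (f j)) \<and>
        (\<forall>l. X i * g k l = (\<Sum>j<k. f j * g j l))"
    using assms unfolding involutive_basis_def by blast
  from this[unfolded choice_iff] obtain f where f: "\<forall>k i. k < b \<and> i \<in> {1..<c k} \<longrightarrow>
        (\<forall>j<k. f k i j \<in> polys {c j..N} \<and> homogeneous 1 (f k i j)) \<and>
        (\<forall>l. X i * g k l = (\<Sum>j<k. f k i j * g j l))"
    by (elim exE) (rule that)
  interpret involutive N r b c g f
  proof
    show "h k = 0" if "\<And>k. k < b \<Longrightarrow> h k \<in> polys {c k..N}" "\<And>l. (\<Sum>k<b. h k * g k l) = 0" "k < b" for h k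
      using assms that unfolding involutive_basis_def by blast
  qed (use f assms in \<open>auto simp: involutive_basis_def\<close>)
  define P where "P = (SIGMA k:{..<b}. {1..<c k})"
  have finP: "finite P" by (simp add: P_def)
  define \<kappa> where "\<kappa> = (\<lambda>(k, i). k * Suc N + i)"
  obtain e where e: "bij_betw e {..<card P} P"
    "\<And>p q. p < card P \<Longrightarrow> q < card P \<Longrightarrow> \<kappa> (e p) < \<kappa> (e q) \<Longrightarrow> p < q"
    using enumerate_by_key[OF finP, of \<kappa>] by blast
  define b' where "b' = card P"
  define ix where "ix = inv_into {..<b'} e"
  have ix: "ix (e q) = q" if "q < b'" for q
    using e(1) that unfolding ix_def b'_def by (intro inv_into_f_f) (auto simp: bij_betw_def)
  have eP: "fst (e q) < b" "snd (e q) \<in> {1..<c (fst (e q))}" "snd (e q) \<le> N" if "q < b'" for q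
  proof -
    have "e q \<in> P" using e(1) that unfolding b'_def by (auto simp: bij_betw_def)
    then show "fst (e q) < b" "snd (e q) \<in> {1..<c (fst (e q))}" by (auto simp: P_def)
    then show "snd (e q) \<le> N" using class_bounds[of "fst (e q)"] by auto
  qed
  have ixP: "ix (k, i) < b'" "e (ix (k, i)) = (k, i)" if "k < b" "i \<in> {1..<c k}" for k i
  proof -
    have "(k, i) \<in> e ` {..<b'}" using e(1) that unfolding b'_def by (auto simp: bij_betw_def P_def)
    then obtain q where q: "q < b'" "(k, i) = e q" by auto
    then show "ix (k, i) < b'" "e (ix (k, i)) = (k, i)"
      using ix[OF q(1)] by simp_all
  qed
  define s where "s = (\<lambda>q. syz (fst (e q)) (snd (e q)))"
  have flatten: "(\<Sum>q<b'. G (e q)) = (\<Sum>k<b. \<Sum>i \<in> {1..<c k}. G (k, i))" for G :: "nat \<times> nat \<Rightarrow> 'k mpoly"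
  proof -
    have "(\<Sum>q<b'. G (e q)) = (\<Sum>x \<in> P. G x)"
      unfolding b'_def by (rule sum.reindex_bij_betw[OF e(1)])
    also have "\<dots> = (\<Sum>k<b. \<Sum>i \<in> {1..<c k}. G (k, i))"
      unfolding P_def by (subst sum.Sigma) (auto simp: case_prod_unfold)
    finally show ?thesis .
  qed
  have comb: "(\<Sum>q<b'. w q * s q l) = (\<Sum>k<b. \<Sum>i \<in> {1..<c k}. w (ix (k, i)) * syz k i l)" for w l
  proof -
    have "(\<Sum>q<b'. w q * s q l) = (\<Sum>q<b'. w (ix (e q)) * syz (fst (e q)) (snd (e q)) l)"
      by (rule sum.cong) (auto simp: ix s_def)
    also have "\<dots> = (\<Sum>k<b. \<Sum>i \<in> {1..<c k}. w (ix (k, i)) * syz k i l)"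
      using flatten[of "\<lambda>x. w (ix x) * syz (fst x) (snd x) l"] by simp
    finally show ?thesis .
  qed
  have inv: "involutive_basis N b b' (\<lambda>q. snd (e q)) s"
    unfolding involutive_basis_def
  proof (intro conjI allI impI ballI)
    fix q assume q: "q < b'"
    show "s q \<in> free_mod {1..N} b" using eP[OF q] syz_free_mod by (simp add: s_def)
    show "1 \<le> snd (e q)" "snd (e q) \<le> Suc N" using eP[OF q] by auto
  next
    fix h q assume h: "(\<forall>q<b'. h q \<in> polys {snd (e q)..N}) \<and> (\<forall>l. (\<Sum>q<b'. h q * s q l) = 0)" and q: "q < b'"
    have "h (ix (fst (e q), snd (e q))) = 0"
    proof (rule syz_independent[of "\<lambda>k i. h (ix (k, i))"])
      fix k i assume "k < b" "i \<in> {1..<c k}"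
      then show "h (ix (k, i)) \<in> polys {i..N}" using h ixP[of k i] by (metis snd_conv)
    next
      show "(\<Sum>k<b. \<Sum>i \<in> {1..<c k}. h (ix (k, i)) * syz k i l) = 0" for l
        using h by (simp flip: comb)
    qed (use eP[OF q] in auto)
    then show "h q = 0" using ix[OF q] by simp
  next
    fix q j assume q: "q < b'" and j: "j \<in> {1..<snd (e q)}"
    let ?k = "fst (e q)" and ?i = "snd (e q)"
    obtain F where F: "\<forall>k'<b. \<forall>i' \<in> {1..<c k'}. F k' i' \<in> polys {i'..N} \<and> homogeneous 1 (F k' i') \<and>
              (F k' i' \<noteq> 0 \<longrightarrow> k' < ?k \<or> k' = ?k \<and> i' < ?i)"
      "\<forall>l. X j * syz ?k ?i l = (\<Sum>k'<b. \<Sum>i' \<in> {1..<c k'}. F k' i' * syz k' i' l)"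
      using syz_rewriting[OF eP(1,2)[OF q] j] by blast
    let ?f = "\<lambda>p. F (fst (e p)) (snd (e p))"
    have zero: "?f p = 0" if p: "p < b'" "q \<le> p" for p
    proof (rule ccontr)
      assume "?f p \<noteq> 0"
      then have "fst (e p) < ?k \<or> fst (e p) = ?k \<and> snd (e p) < ?i" using F(1) eP[OF p(1)] by blast
      then have "\<kappa> (e p) < \<kappa> (e q)"
      proof
        assume "fst (e p) < ?k"
        then have "Suc (fst (e p)) * Suc N \<le> ?k * Suc N" by (intro mult_le_mono1) simp
        then show ?thesis using eP(3)[OF p(1)] by (simp add: \<kappa>_def case_prod_unfold)
      qed (simp add: \<kappa>_def case_prod_unfold)
      then have "p < q" using e(2) p q by (simp add: b'_def)
      then show False using p by simp
    qed
    have "X j * s q l = (\<Sum>p<q. ?f p * s p l)" for l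
    proof -
      have "X j * s q l = (\<Sum>k'<b. \<Sum>i' \<in> {1..<c k'}. F k' i' * syz k' i' l)"
        using F(2) by (simp add: s_def)
      also have "\<dots> = (\<Sum>p<b'. ?f p * s p l)"
        using flatten[of "\<lambda>x. F (fst x) (snd x) * syz (fst x) (snd x) l"] by (simp add: s_def)
      also have "\<dots> = (\<Sum>p<q. ?f p * s p l)"
        using q zero by (intro sum.mono_neutral_right) auto
      finally show ?thesis .
    qed
    moreover have "?f p \<in> polys {snd (e p)..N} \<and> homogeneous 1 (?f p)" if "p < q" for p
      using F(1) eP[of p] that q by simp
    ultimately show "\<exists>f. (\<forall>p<q. f p \<in> polys {snd (e p)..N} \<and> homogeneous 1 (f p)) \<and>
        (\<forall>l. X j * s q l = (\<Sum>p<q. f p * s p l))"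
      by (intro exI[of _ ?f]) blast
  qed
  have hom: "\<forall>q<b'. \<forall>l. homogeneous 1 (s q l)"
    using eP syz_homogeneous by (simp add: s_def)
  have "syzygies N b g = (\<lambda>w l. \<Sum>q<b'. w q * s q l) ` free_mod {1..N} b'"
  proof (intro equalityI subsetI)
    fix v assume "v \<in> syzygies N b g"
    then have v: "\<And>k. v k \<in> polys {1..N}" "\<And>k. b \<le> k \<Longrightarrow> v k = 0" "\<And>l. (\<Sum>k<b. v k * g k l) = 0"
      by (auto simp: syzygies_def free_mod_def) (metis not_le polys_zero)
    obtain w where w: "\<forall>k<b. \<forall>i \<in> {1..<c k}. w k i \<in> polys {i..N}"
      "\<forall>l. v l = (\<Sum>k<b. \<Sum>i \<in> {1..<c k}. w k i * syz k i l)"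
      using syzygy_representation[OF order_refl v] by blast
    define W where "W = (\<lambda>q. if q < b' then w (fst (e q)) (snd (e q)) else 0)"
    have "W q \<in> polys {1..N}" if "q < b'" for q
    proof -
      have "W q \<in> polys {snd (e q)..N}" using w(1) eP[OF that] that by (simp add: W_def)
      moreover have "1 \<le> snd (e q)" using eP(2)[OF that] by simp
      ultimately show ?thesis by (rule polys_tail)
    qed
    then have "W \<in> free_mod {1..N} b'" by (simp add: free_mod_def W_def)
    moreover have "v = (\<lambda>l. \<Sum>q<b'. W q * s q l)"
    proof
      fix l
      have "(\<Sum>q<b'. W q * s q l) = (\<Sum>q<b'. w (fst (e q)) (snd (e q)) * syz (fst (e q)) (snd (e q)) l)"
        by (simp add: W_def s_def)
      also have "\<dots> = v l"
        using flatten[of "\<lambda>x. w (fst x) (snd x) * syz (fst x) (snd x) l"] w(2) by simp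
      finally show "v l = (\<Sum>q<b'. W q * s q l)" by simp
    qed
    ultimately show "v \<in> (\<lambda>w l. \<Sum>q<b'. w q * s q l) ` free_mod {1..N} b'" by blast
  next
    fix v assume "v \<in> (\<lambda>w l. \<Sum>q<b'. w q * s q l) ` free_mod {1..N} b'"
    then obtain w where w: "w \<in> free_mod {1..N} b'" "v = (\<lambda>l. \<Sum>q<b'. w q * s q l)" by blast
    have sf: "s q \<in> free_mod {1..N} b" if "q < b'" for q
      using inv that by (simp add: involutive_basis_def)
    have "v \<in> free_mod {1..N} b"
      using w(1) sf unfolding w(2) free_mod_def
      by (auto intro!: polys_sum polys_mult sum.neutral)
    moreover have "(\<Sum>l<b. v l * g l t) = 0" for t
    proof -
      have "(\<Sum>l<b. v l * g l t) = (\<Sum>l<b. \<Sum>q<b'. w q * (s q l * g l t))"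
        by (simp add: w(2) sum_distrib_right mult.assoc)
      also have "\<dots> = (\<Sum>q<b'. \<Sum>l<b. w q * (s q l * g l t))" by (rule sum.swap)
      also have "\<dots> = (\<Sum>q<b'. w q * (\<Sum>l<b. s q l * g l t))" by (simp add: sum_distrib_left)
      also have "\<dots> = 0"
        using eP syz_is_syzygy by (intro sum.neutral) (simp add: s_def)
      finally show ?thesis .
    qed
    ultimately show "v \<in> syzygies N b g" by (simp add: syzygies_def)
  qed
  with inv hom show ?thesis by blast
qed

section \<open>The minimal generators of a principal Borel ideal\<close>

definition borel_gens :: "nat \<Rightarrow> (nat \<Rightarrow>\<^sub>0 nat) \<Rightarrow> (nat \<Rightarrow>\<^sub>0 nat) set" where
  "borel_gens N u = {m \<in> dominating N u. vdeg {1..N} m = vdeg {1..N} u}"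

text \<open>
  The value at the monomial 1 is 1, so that all variables are allowed in the coefficient of the
  generator of the unit ideal.
\<close>

definition max_var :: "(nat \<Rightarrow>\<^sub>0 nat) \<Rightarrow> nat" where
  "max_var m = Max (insert 1 (Poly_Mapping.keys m))"

lemma max_var_ge: "t \<in> Poly_Mapping.keys m \<Longrightarrow> t \<le> max_var m"
  by (simp add: max_var_def)

lemma one_le_max_var: "1 \<le> max_var m"
  unfolding max_var_def by (rule Max_ge) simp_all

lemma max_var_cases: "max_var m = 1 \<or> max_var m \<in> Poly_Mapping.keys m"
  using Max_in[of "insert 1 (Poly_Mapping.keys m)"] unfolding max_var_def by auto

lemma max_var_le: "1 \<le> a \<Longrightarrow> (\<And>t. t \<in> Poly_Mapping.keys m \<Longrightarrow> t \<le> a) \<Longrightarrow> max_var m \<le> a"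
  by (simp add: max_var_def)

lemma finite_borel_gens: "finite (borel_gens N u)"
proof (rule finite_subset)
  let ?B = "vdeg {1..N} u"
  show "borel_gens N u \<subseteq> (\<lambda>\<phi>. expvec N \<phi>) ` ({1..N} \<rightarrow>\<^sub>E {..?B})"
  proof
    fix m assume "m \<in> borel_gens N u"
    then have m: "m \<in> mons {1..N}" "vdeg {1..N} m = ?B"
      by (auto simp: borel_gens_def dominating_def)
    let ?\<phi> = "restrict (Poly_Mapping.lookup m) {1..N}"
    have "Poly_Mapping.lookup m t \<le> vdeg {1..N} m" if "t \<in> {1..N}" for t
      unfolding vdeg_def using that by (intro member_le_sum) auto
    then have "?\<phi> \<in> {1..N} \<rightarrow>\<^sub>E {..?B}" by (auto simp: m(2))
    moreover have "m = expvec N ?\<phi>"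
      by (rule mons_eqI[OF m(1) expvec_in_mons]) (auto simp: lookup_expvec)
    ultimately show "m \<in> (\<lambda>\<phi>. expvec N \<phi>) ` ({1..N} \<rightarrow>\<^sub>E {..?B})" by blast
  qed
  show "finite ((\<lambda>\<phi>. expvec N \<phi>) ` ({1..N} \<rightarrow>\<^sub>E {..?B}))"
    by (intro finite_imageI finite_PiE) auto
qed

lemma eq_if_vdeg_eq_and_le:
  assumes "m \<in> mons {1..N}" "w \<in> mons {1..N}" "vdeg {1..N} m = vdeg {1..N} w"
    and "\<And>t. t \<in> {1..N} \<Longrightarrow> Poly_Mapping.lookup m t \<le> Poly_Mapping.lookup w t"
  shows "m = w"
proof (rule mons_eqI[OF assms(1,2)])
  fix t assume t: "t \<in> {1..N}"
  show "Poly_Mapping.lookup m t = Poly_Mapping.lookup w t"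
  proof (rule ccontr)
    assume "\<not> ?thesis"
    then have "vdeg {1..N} m < vdeg {1..N} w"
      unfolding vdeg_def using assms(4) t
      by (intro sum_strict_mono_ex1) (auto simp: order.strict_iff_order)
    then show False using assms(3) by simp
  qed
qed

text \<open>
  Suppose the largest variable \<open>a\<close> of \<open>m\<close> does not exceed that of \<open>m'\<close>.  Then \<open>m\<close> and \<open>m'\<close> agree below \<open>a\<close>, and
  \<open>m\<close> vanishes beyond \<open>a\<close>.  If \<open>m\<close> has the larger exponent at \<open>a\<close>, then \<open>x\<^sub>a\<close> occurs
  in \<open>w'\<close>, so that \<open>a\<close> is the largest variable of \<open>m'\<close> too.  In any case one of \<open>m\<close> and \<open>m'\<close> divides the
  other, and equality of the degrees makes them equal.
\<close>

lemma involutive_decomposition_unique: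
  assumes m: "m \<in> mons {1..N}" "m' \<in> mons {1..N}" "vdeg {1..N} m = vdeg {1..N} m'"
    and w: "w \<in> mons {max_var m..N}" "w' \<in> mons {max_var m'..N}"
    and eq: "m + w = m' + w'"
  shows "m = m'"
proof -
  have *: "m = m'"
    if m: "m \<in> mons {1..N}" "m' \<in> mons {1..N}" "vdeg {1..N} m = vdeg {1..N} m'"
      and w: "w \<in> mons {max_var m..N}" "w' \<in> mons {max_var m'..N}"
      and eq: "m + w = m' + w'" and le: "max_var m \<le> max_var m'" for m m' w w'
  proof -
    have look: "Poly_Mapping.lookup m t + Poly_Mapping.lookup w t =
        Poly_Mapping.lookup m' t + Poly_Mapping.lookup w' t" for t
      using arg_cong[OF eq, of "\<lambda>p. Poly_Mapping.lookup p t"] by (simp add: lookup_add)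
    have low: "Poly_Mapping.lookup m t = Poly_Mapping.lookup m' t" if "t < max_var m" for t
      using look[of t] mons_lookup_zero[OF w(1), of t] mons_lookup_zero[OF w(2), of t] that le by simp
    have high: "Poly_Mapping.lookup m t = 0" if "max_var m < t" for t
      using max_var_ge[of t m] that by (auto simp: in_keys_iff)
    have high': "Poly_Mapping.lookup m' t = 0" if "max_var m' < t" for t
      using max_var_ge[of t m'] that by (auto simp: in_keys_iff)
    show ?thesis
    proof (cases "Poly_Mapping.lookup m (max_var m) \<le> Poly_Mapping.lookup m' (max_var m)")
      case True
      then have "Poly_Mapping.lookup m t \<le> Poly_Mapping.lookup m' t" for t
        using low[of t] high[of t] by (cases t "max_var m" rule: linorder_cases) auto
      then show ?thesis by (rule eq_if_vdeg_eq_and_le[OF m])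
    next
      case False
      have "max_var m' = max_var m"
      proof (rule ccontr)
        assume "\<not> ?thesis"
        then have "Poly_Mapping.lookup w' (max_var m) = 0"
          using le by (intro mons_lookup_zero[OF w(2)]) auto
        then show False using look[of "max_var m"] False by simp
      qed
      then have "Poly_Mapping.lookup m' t \<le> Poly_Mapping.lookup m t" for t
        using low[of t] high'[of t] False by (cases t "max_var m" rule: linorder_cases) auto
      then show ?thesis using eq_if_vdeg_eq_and_le[OF m(2,1) m(3)[symmetric]] by simp
    qed
  qed
  show ?thesis
  proof (cases "max_var m \<le> max_var m'")
    case True
    then show ?thesis using *[OF m w eq] by blast
  next
    case False
    then show ?thesis using *[OF m(2,1) m(3)[symmetric] w(2,1) eq[symmetric]] by simp
  qed
qed

text \<open>
  Dividing by the largest variable keeps dominance as long as the degree exceeds that of \<open>u\<close>, since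
  only the partial degrees equal to the full degree drop.
\<close>

lemma dominating_has_generator:
  assumes u: "u \<in> mons {1..N}" and m: "m \<in> dominating N u"
  shows "\<exists>v \<in> borel_gens N u. \<exists>w \<in> mons {1..N}. m = v + w"
  using m
proof (induction "vdeg {1..N} m" arbitrary: m rule: less_induct)
  case less
  have mm: "m \<in> mons {1..N}" and dom: "\<And>j. j \<le> N \<Longrightarrow> vdeg {1..j} u \<le> vdeg {1..j} m"
    using less.prems by (auto simp: dominating_def)
  show ?case
  proof (cases "vdeg {1..N} m = vdeg {1..N} u")
    case True
    then show ?thesis
      using less.prems by (intro bexI[of _ m] bexI[of _ 0]) (auto simp: borel_gens_def)
  next
    case False
    then have gt: "vdeg {1..N} u < vdeg {1..N} m" using dom[of N] by simp
    then have "m \<noteq> 0" by auto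
    define a where "a = Max (Poly_Mapping.keys m)"
    have a: "a \<in> Poly_Mapping.keys m" unfolding a_def using \<open>m \<noteq> 0\<close> by (intro Max_in) auto
    then have aN: "a \<in> {1..N}" using mm by (auto simp: mons_def)
    let ?e = "Poly_Mapping.single a 1 :: nat \<Rightarrow>\<^sub>0 nat"
    have split: "?e + (m - ?e) = m" using a by (intro single_plus_diff) (simp add: in_keys_iff)
    have v: "vdeg {1..j} m = (if a \<le> j then 1 else 0) + vdeg {1..j} (m - ?e)" for j
      using arg_cong[OF split, of "vdeg {1..j}"] aN by (simp add: vdeg_single)
    have "vdeg {1..j} u \<le> vdeg {1..j} (m - ?e)" if j: "j \<le> N" for j
    proof (cases "a \<le> j")
      case True
      have "vdeg {1..j} m = vdeg {1..N} m"
        unfolding vdeg_def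
      proof (rule sum.mono_neutral_left)
        show "\<forall>t \<in> {1..N} - {1..j}. Poly_Mapping.lookup m t = 0"
        proof
          fix t assume "t \<in> {1..N} - {1..j}"
          then have "a < t" using True by auto
          then show "Poly_Mapping.lookup m t = 0"
            using Max_ge[OF finite_keys, of t m] unfolding a_def in_keys_iff by fastforce
        qed
      qed (use j in auto)
      moreover have "vdeg {1..j} u \<le> vdeg {1..N} u" using j by (intro vdeg_mono) auto
      ultimately show ?thesis using gt v[of j] True by simp
    next
      case False
      then show ?thesis using dom[OF j] v[of j] by simp
    qed
    then have "m - ?e \<in> dominating N u" using mm by (simp add: dominating_def mons_diff)
    moreover have "vdeg {1..N} (m - ?e) < vdeg {1..N} m" using v[of N] aN by simp
    ultimately obtain x w where xw: "x \<in> borel_gens N u" "w \<in> mons {1..N}" "m - ?e = x + w"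
      using less.hyps by blast
    have "m = x + (w + ?e)" using split xw(3) by (simp add: algebra_simps)
    moreover have "w + ?e \<in> mons {1..N}" using xw(2) aN by simp
    ultimately show ?thesis using xw(1) by blast
  qed
qed

lemma borel_gens_move:
  assumes m: "m \<in> borel_gens N u" and i: "i \<in> {1..<max_var m}"
  defines "v \<equiv> Poly_Mapping.single i 1 + (m - Poly_Mapping.single (max_var m) 1)"
  shows "v \<in> borel_gens N u" "Poly_Mapping.single i 1 + m = v + Poly_Mapping.single (max_var m) 1"
    "max_var v \<le> max_var m"
proof -
  have key: "max_var m \<in> Poly_Mapping.keys m" using max_var_cases[of m] i by auto
  then have one: "1 \<le> Poly_Mapping.lookup m (max_var m)" by (simp add: in_keys_iff)
  have mm: "m \<in> mons {1..N}" using m by (simp add: borel_gens_def dominating_def)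
  then have N: "max_var m \<in> {1..N}" using key by (auto simp: mons_def)
  have vd: "vdeg {1..l} v = vdeg {1..l} m + (if i \<le> l \<and> l < max_var m then 1 else 0)" for l
    unfolding v_def using i one by (intro vdeg_borel_move) auto
  have "v \<in> mons {1..N}" unfolding v_def using mm i N by (auto intro: mons_diff)
  then show "v \<in> borel_gens N u"
    using m N by (auto simp: borel_gens_def dominating_def vd intro: trans_le_add1)
  show "Poly_Mapping.single i 1 + m = v + Poly_Mapping.single (max_var m) 1"
    using single_plus_diff[OF one] by (simp add: v_def algebra_simps)
  show "max_var v \<le> max_var m"
  proof (rule max_var_le[OF one_le_max_var])
    fix t assume "t \<in> Poly_Mapping.keys v"
    then have "t = i \<or> t \<in> Poly_Mapping.keys m"
      by (auto simp: v_def in_keys_iff lookup_add lookup_minus lookup_single when_def split: if_splits)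
    then show "t \<le> max_var m" using i max_var_ge by auto
  qed
qed

text \<open>
  A Borel move lowers this weight, so that generators listed by increasing weight can be rewritten by
  preceding ones.
\<close>

definition index_weight :: "nat \<Rightarrow> (nat \<Rightarrow>\<^sub>0 nat) \<Rightarrow> nat" where
  "index_weight N m = (\<Sum>t \<in> {1..N}. t * Poly_Mapping.lookup m t)"

lemma index_weight_add: "index_weight N (m + w) = index_weight N m + index_weight N w"
  by (simp add: index_weight_def lookup_add algebra_simps sum.distrib)

lemma index_weight_single: "t \<in> {1..N} \<Longrightarrow> index_weight N (Poly_Mapping.single t a) = t * a"
  by (simp add: index_weight_def lookup_single when_def if_distrib[of "\<lambda>x. _ * x"] cong: if_cong)

text \<open>
  For \<open>i\<close> below the largest variable \<open>a\<close> of \<open>m\<close>, one has \<open>x\<^sub>i m = x\<^sub>a v\<close> with the Borel move \<open>v = m x\<^sub>i / x\<^sub>a\<close>, and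
  \<open>x\<^sub>a\<close> is an allowed coefficient for \<open>v\<close> because the variables of \<open>v\<close> do not exceed \<open>x\<^sub>a\<close>.
\<close>

lemma borel_gens_involutive:
  assumes e: "bij_betw e {..<b} (borel_gens N u)"
    and order: "\<And>p q. p < b \<Longrightarrow> q < b \<Longrightarrow> index_weight N (e p) < index_weight N (e q) \<Longrightarrow> p < q"
  shows "involutive_basis N 1 b (\<lambda>k. max_var (e k)) (\<lambda>k l. if l = (0::nat) then (monomial (e k) :: 'k::field mpoly) else 0)"
  unfolding involutive_basis_def
proof (intro conjI allI impI ballI)
  have gen: "e k \<in> borel_gens N u" if "k < b" for k
    using e that by (auto simp: bij_betw_def)
  then have mon: "e k \<in> mons {1..N}" "vdeg {1..N} (e k) = vdeg {1..N} u" if "k < b" for k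
    using that by (auto simp: borel_gens_def dominating_def)
  {
    fix k assume k: "k < b"
    show "(\<lambda>l. if l = 0 then (monomial (e k) :: 'k mpoly) else 0) \<in> free_mod {1..N} 1"
      using mon[OF k] by (simp add: free_mod_def)
    show "1 \<le> max_var (e k)" by (rule one_le_max_var)
    show "max_var (e k) \<le> Suc N"
      by (rule max_var_le) (use mon(1)[OF k] in \<open>auto simp: mons_def\<close>)
  }
  {
    fix h :: "nat \<Rightarrow> 'k mpoly" and k
    assume h: "(\<forall>k<b. h k \<in> polys {max_var (e k)..N}) \<and>
        (\<forall>l::nat. (\<Sum>k<b. h k * (if l = 0 then monomial (e k) else 0)) = 0)" and k: "k < b"
    have "Poly_Mapping.lookup (h k) w = 0" for w
    proof (rule ccontr)
      assume "Poly_Mapping.lookup (h k) w \<noteq> 0"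
      then have w: "w \<in> Poly_Mapping.keys (h k)" by (simp add: in_keys_iff)
      then have wm: "w \<in> mons {max_var (e k)..N}" using h k by (auto simp: polys_iff)
      have "Poly_Mapping.lookup (h j * monomial (e j)) (w + e k) = 0" if j: "j \<in> {..<b} - {k}" for j
      proof (rule ccontr)
        assume "\<not> ?thesis"
        then obtain w' where w': "w' \<in> Poly_Mapping.keys (h j)" "w + e k = w' + e j"
          using keys_mult_monomial[of "h j" "e j"] by (auto simp: in_keys_iff[symmetric])
        have "w' \<in> mons {max_var (e j)..N}" using w'(1) h j by (auto simp: polys_iff)
        then have "e k = e j"
          using involutive_decomposition_unique[of "e k" N "e j" w w'] mon k j wm w'(2)
          by (simp add: add.commute)
        then show False using e j k by (auto simp: bij_betw_def dest: inj_onD)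
      qed
      then have "(\<Sum>j \<in> {..<b} - {k}. Poly_Mapping.lookup (h j * monomial (e j)) (w + e k)) = 0"
        by (intro sum.neutral) blast
      moreover have "(\<Sum>j<b. h j * monomial (e j)) = 0" using h[THEN conjunct2, rule_format, of 0] by simp
      then have "(\<Sum>j<b. Poly_Mapping.lookup (h j * monomial (e j)) (w + e k)) = 0"
        by (simp flip: lookup_sum)
      ultimately have "Poly_Mapping.lookup (h k * monomial (e k)) (w + e k) = 0"
        using k by (simp add: sum.remove[of "{..<b}" k])
      then show False using w by (simp add: lookup_mult_monomial in_keys_iff)
    qed
    then show "h k = 0" by (intro poly_mapping_eqI) simp
  }
  fix k i assume k: "k < b" and i: "i \<in> {1..<max_var (e k)}"
  let ?a = "max_var (e k)"
  let ?v = "Poly_Mapping.single i 1 + (e k - Poly_Mapping.single ?a 1)"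
  note v = borel_gens_move[OF gen[OF k] i]
  obtain j where j: "j < b" "e j = ?v" using v(1) e by (metis bij_betw_iff_bijections lessThan_iff)
  have "?a \<in> Poly_Mapping.keys (e k)" using max_var_cases[of "e k"] i by auto
  then have aN: "?a \<in> {1..N}" using mon(1)[OF k] by (auto simp: mons_def)
  have "i + index_weight N (e k) = index_weight N ?v + ?a"
    using arg_cong[OF v(2), of "index_weight N"] i aN
    by (simp only: index_weight_add index_weight_single) (simp add: index_weight_single)
  then have "j < k" using order[OF j(1) k] j(2) i by simp
  define F where "F = (\<lambda>l. if l = j then X ?a else (0 :: 'k mpoly))"
  have "X i * monomial (e k) = X ?a * (monomial ?v :: 'k mpoly)"
    using v(2) by (simp add: X_def add.commute flip: monomial_add)
  then have F_eq: "X i * (if l = 0 then (monomial (e k) :: 'k mpoly) else 0) = (\<Sum>j<k. F j * (if l = 0 then monomial (e j) else 0))" for l :: nat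
    using \<open>j < k\<close> j(2) by (simp add: F_def if_distrib[of "\<lambda>x. x * _"] cong: if_cong)
  have F_coeff: "F l \<in> polys {max_var (e l)..N} \<and> homogeneous 1 (F l)" for l
    using v(3) aN j(2) by (auto simp: F_def intro!: polys_X)
  show "\<exists>f. (\<forall>j<k. f j \<in> polys {max_var (e j)..N} \<and> homogeneous 1 (f j)) \<and>
      (\<forall>l::nat. X i * (if l = 0 then monomial (e k) else 0) = (\<Sum>j<k. f j * (if l = 0 then (monomial (e j) :: 'k mpoly) else 0)))"
    using F_coeff F_eq by (intro exI[of _ F]) blast
qed

lemma borel_gens_generate:
  assumes u: "u \<in> mons {1..N}" and e: "bij_betw e {..<b} (borel_gens N u)"
  shows "{\<Sum>k<b. monomial (e k) * v k |v. v \<in> free_mod {1..N} b} =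
           (mon_span (dominating N u) :: 'k::field mpoly set)"
proof (intro equalityI subsetI)
  fix f :: "'k mpoly" assume "f \<in> {\<Sum>k<b. monomial (e k) * v k |v. v \<in> free_mod {1..N} b}"
  then obtain v where v: "v \<in> free_mod {1..N} b" "f = (\<Sum>k<b. monomial (e k) * v k)" by blast
  have "monomial (e k) * v k \<in> mon_span (dominating N u)" if "k < b" for k
  proof (rule mon_span_mult[where E = "{e k}" and F = "mons {1..N}"])
    have "e k \<in> dominating N u" using e that by (auto simp: bij_betw_def borel_gens_def)
    then show "a + w \<in> dominating N u" if "a \<in> {e k}" "w \<in> mons {1..N}" for a w
      using that upset_dominating[of N u] by (auto simp: upset_def)
    show "v k \<in> mon_span (mons {1..N})"
      using v(1) that by (simp add: free_mod_def polys_eq_mon_span)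
  qed simp
  then show "f \<in> mon_span (dominating N u)" unfolding v(2) by (intro mon_span_sum) simp
next
  fix f :: "'k mpoly" assume f: "f \<in> mon_span (dominating N u)"
  have "\<forall>m \<in> Poly_Mapping.keys f. \<exists>k w. k < b \<and> w \<in> mons {1..N} \<and> m = e k + w"
  proof
    fix m assume "m \<in> Poly_Mapping.keys f"
    then obtain x w where "x \<in> borel_gens N u" "w \<in> mons {1..N}" "m = x + w"
      using dominating_has_generator[OF u, of m] f by (auto simp: mon_span_def)
    moreover from this(1) obtain k where "k < b" "x = e k"
      using e by (metis bij_betw_iff_bijections lessThan_iff)
    ultimately show "\<exists>k w. k < b \<and> w \<in> mons {1..N} \<and> m = e k + w" by blast
  qed
  then obtain \<kappa> w where kw: "\<And>m. m \<in> Poly_Mapping.keys f \<Longrightarrow> \<kappa> m < b \<and> w m \<in> mons {1..N} \<and> m = e (\<kappa> m) + w m"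
    by metis
  define v where "v = (\<lambda>k. if k < b then \<Sum>m \<in> {m \<in> Poly_Mapping.keys f. \<kappa> m = k}.
      Poly_Mapping.single (w m) (Poly_Mapping.lookup f m) else 0)"
  have "v \<in> free_mod {1..N} b"
    using kw by (auto simp: free_mod_def v_def polys_eq_mon_span single_in_mon_span intro!: mon_span_sum)
  moreover have "f = (\<Sum>k<b. monomial (e k) * v k)"
  proof -
    have "(\<Sum>k<b. monomial (e k) * v k) =
        (\<Sum>k<b. \<Sum>m \<in> {m \<in> Poly_Mapping.keys f. \<kappa> m = k}. Poly_Mapping.single m (Poly_Mapping.lookup f m))"
    proof (rule sum.cong[OF refl])
      fix k assume "k \<in> {..<b}"
      then have "monomial (e k) * v k = (\<Sum>m \<in> {m \<in> Poly_Mapping.keys f. \<kappa> m = k}.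
          Poly_Mapping.single (e k + w m) (Poly_Mapping.lookup f m))"
        by (simp add: v_def sum_distrib_left monomial_def mult_single)
      also have "\<dots> = (\<Sum>m \<in> {m \<in> Poly_Mapping.keys f. \<kappa> m = k}. Poly_Mapping.single m (Poly_Mapping.lookup f m))"
        using kw by (intro sum.cong) auto
      finally show "monomial (e k) * v k = (\<Sum>m \<in> {m \<in> Poly_Mapping.keys f. \<kappa> m = k}.
          Poly_Mapping.single m (Poly_Mapping.lookup f m))" .
    qed
    also have "\<dots> = (\<Sum>m \<in> Poly_Mapping.keys f. Poly_Mapping.single m (Poly_Mapping.lookup f m))"
      using kw by (intro sum.group) auto
    finally show ?thesis using mpoly_expand[of f] by simp
  qed
  ultimately show "f \<in> {\<Sum>k<b. monomial (e k) * v k |v. v \<in> free_mod {1..N} b}" by blast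
qed


section \<open>Regularity of a principal Borel ideal\<close>

lemma linear_resolution:
  fixes g :: "nat \<Rightarrow> nat \<Rightarrow> 'k::field mpoly"
  assumes "involutive_basis N r b c g"
  obtains rk G where "rk 0 = b" "G 0 = g"
    "\<And>i k. k < rk (Suc i) \<Longrightarrow> G (Suc i) k \<in> free_mod {1..N} (rk i)"
    "\<And>i k l. k < rk (Suc i) \<Longrightarrow> homogeneous 1 (G (Suc i) k l)"
    "\<And>i. syzygies N (rk i) (G i) = (\<lambda>w l. \<Sum>q<rk (Suc i). w q * G (Suc i) q l) ` free_mod {1..N} (rk (Suc i))"
proof -
  define P where "P = (\<lambda>(n::nat) (b', g' :: nat \<Rightarrow> nat \<Rightarrow> 'k mpoly).
      (\<exists>r' c'. involutive_basis N r' b' c' g') \<and> (n = 0 \<longrightarrow> b' = b \<and> g' = g))"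
  define R where "R = (\<lambda>(n::nat) (b1, g1 :: nat \<Rightarrow> nat \<Rightarrow> 'k mpoly) (b2, g2).
      (\<forall>k<b2. g2 k \<in> free_mod {1..N} b1 \<and> (\<forall>l. homogeneous 1 (g2 k l))) \<and>
      syzygies N b1 g1 = (\<lambda>w l. \<Sum>q<b2. w q * g2 q l) ` free_mod {1..N} b2)"
  have "\<exists>S. \<forall>n. P n (S n) \<and> R n (S n) (S (Suc n))"
  proof (rule dependent_nat_choice)
    show "\<exists>x. P 0 x" using assms by (intro exI[of _ "(b, g)"]) (auto simp: P_def)
    fix x n assume x: "P n x"
    obtain b1 g1 where bg: "x = (b1, g1)" by (cases x)
    then obtain r1 c1 where "involutive_basis N r1 b1 c1 g1" using x by (auto simp: P_def)
    from syzygies_have_involutive_basis[OF this] obtain b2 c2 g2 where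
      s: "involutive_basis N b1 b2 c2 g2" "\<forall>q<b2. \<forall>l. homogeneous 1 (g2 q l)"
        "syzygies N b1 g1 = (\<lambda>w l. \<Sum>q<b2. w q * g2 q l) ` free_mod {1..N} b2"
      by blast
    have "\<forall>k<b2. g2 k \<in> free_mod {1..N} b1" using s(1) by (simp add: involutive_basis_def)
    then have "P (Suc n) (b2, g2) \<and> R n x (b2, g2)"
      using s unfolding P_def R_def bg by auto
    then show "\<exists>y. P (Suc n) y \<and> R n x y" by blast
  qed
  then obtain S where S: "\<And>n. P n (S n)" "\<And>n. R n (S n) (S (Suc n))" by blast
  show thesis
  proof (rule that[of "\<lambda>n. fst (S n)" "\<lambda>n. snd (S n)"])
    show "fst (S 0) = b" "snd (S 0) = g" using S(1)[of 0] by (auto simp: P_def case_prod_unfold)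
  qed (use S(2) in \<open>auto simp: R_def case_prod_unfold\<close>)
qed

text \<open>
  The minimal generators have the degree \<open>d\<close> of \<open>u\<close>, and all entries of the matrices are linear forms.
  So the resolution is minimal, the basis of its \<open>i\<close>-th free module sits in degree \<open>d + i\<close>, and every
  difference \<open>d + i - i\<close> is \<open>d\<close>.
\<close>

theorem has_regularity_dominating:
  assumes u: "u \<in> mons {1..N}"
  shows "has_regularity {1..N} (mon_span (dominating N u) :: 'k::field mpoly set) (int (vdeg {1..N} u))"
proof -
  let ?V = "{1..N}" and ?d = "int (vdeg {1..N} u)"
  define b where "b = card (borel_gens N u)"
  obtain e where e: "bij_betw e {..<b} (borel_gens N u)"
    "\<And>p q. p < b \<Longrightarrow> q < b \<Longrightarrow> index_weight N (e p) < index_weight N (e q) \<Longrightarrow> p < q"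
    using enumerate_by_key[OF finite_borel_gens, where \<kappa> = "index_weight N"] unfolding b_def by blast
  define g where "g = (\<lambda>k l. if l = (0::nat) then (monomial (e k) :: 'k mpoly) else 0)"
  have basis: "involutive_basis N 1 b (\<lambda>k. max_var (e k)) g"
    unfolding g_def by (rule borel_gens_involutive[OF e])
  obtain rk G where rk: "rk 0 = b" and G0: "G 0 = g"
    and G_free: "\<And>i k. k < rk (Suc i) \<Longrightarrow> G (Suc i) k \<in> free_mod {1..N} (rk i)"
    and G_hom: "\<And>i k l. k < rk (Suc i) \<Longrightarrow> homogeneous 1 (G (Suc i) k l)"
    and G_syz: "\<And>i. syzygies N (rk i) (G i) = (\<lambda>w l. \<Sum>q<rk (Suc i). w q * G (Suc i) q l) ` free_mod {1..N} (rk (Suc i))"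
    by (rule linear_resolution[OF basis]) blast
  define D where "D = (\<lambda>i l k. G (Suc i) k l)"
  have apply_D: "mat_apply (rk i) (rk (Suc i)) (D i) w = (\<lambda>l. \<Sum>q<rk (Suc i). w q * G (Suc i) q l)" for i w
  proof
    fix l
    show "mat_apply (rk i) (rk (Suc i)) (D i) w l = (\<Sum>q<rk (Suc i). w q * G (Suc i) q l)"
      using G_free by (auto simp: mat_apply_def D_def free_mod_def mult.commute intro!: sum.neutral[symmetric])
  qed
  have gens: "e k \<in> borel_gens N u" if "k < b" for k
    using e(1) that by (auto simp: bij_betw_def)
  have D_poly: "D i l k \<in> polys ?V" if "l < rk i" "k < rk (Suc i)" for i l k
    using G_free[OF that(2)] that(1) by (simp add: free_mod_def D_def)
  have "minimal_graded_free_resolution ?V (mon_span (dominating N u)) rk (\<lambda>i k. ?d + int i) (\<lambda>k. monomial (e k)) D"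
    unfolding minimal_graded_free_resolution_def
  proof (intro conjI allI impI)
    fix k assume "k < rk 0"
    then have "e k \<in> mons ?V" "vdeg ?V (e k) = vdeg ?V u"
      using gens[of k] by (auto simp: rk borel_gens_def dominating_def)
    then show "(monomial (e k) :: 'k mpoly) \<in> polys ?V" "homogeneous (?d + int 0) (monomial (e k) :: 'k mpoly)"
      using mdeg_eq_vdeg[of ?V "e k"] by (simp_all add: homogeneous_iff)
  next
    fix i l k assume lk: "l < rk i" "k < rk (Suc i)"
    show "D i l k \<in> polys ?V" by (rule D_poly[OF lk])
    show "homogeneous (?d + int (Suc i) - (?d + int i)) (D i l k)"
      using G_hom[OF lk(2)] by (simp add: D_def)
    show "D i l k \<in> var_ideal ?V ?V"
    proof -
      have "D i l k \<in> mon_span (mons ?V)" using D_poly[OF lk] by (simp add: polys_eq_mon_span)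
      moreover have "D i l k \<in> mon_span {m. int (mdeg m) = 1}"
        using G_hom[OF lk(2)] by (simp add: D_def homogeneous_iff)
      moreover have "1 \<le> vdeg ?V m" if "m \<in> mons ?V" "int (mdeg m) = 1" for m
        using that mdeg_eq_vdeg[of ?V m] by simp
      ultimately show ?thesis by (auto simp: var_ideal_eq mon_span_def subset_iff)
    qed
  next
    show "{\<Sum>k<rk 0. monomial (e k) * v k |v. v \<in> free_mod ?V (rk 0)} = (mon_span (dominating N u) :: 'k mpoly set)"
      unfolding rk by (rule borel_gens_generate[OF u e(1)])
  next
    have "(\<Sum>k<rk 0. v k * g k l) = (if l = 0 then \<Sum>k<rk 0. monomial (e k) * v k else 0)" for v l
      by (simp add: g_def mult.commute)
    then have "{v \<in> free_mod ?V (rk 0). (\<Sum>k<rk 0. monomial (e k) * v k) = 0} = syzygies N (rk 0) (G 0)"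
      by (auto simp: syzygies_def G0)
    also have "\<dots> = mat_apply (rk 0) (rk (Suc 0)) (D 0) ` free_mod ?V (rk (Suc 0))"
      unfolding G_syz apply_D by simp
    finally show "{v \<in> free_mod ?V (rk 0). (\<Sum>k<rk 0. monomial (e k) * v k) = 0} =
        mat_apply (rk 0) (rk 1) (D 0) ` free_mod ?V (rk 1)" by (simp only: One_nat_def)
  next
    fix i
    have "{v \<in> free_mod ?V (rk (Suc i)). mat_apply (rk i) (rk (Suc i)) (D i) v = (\<lambda>_. 0)} = syzygies N (rk (Suc i)) (G (Suc i))"
      by (simp add: apply_D syzygies_def fun_eq_iff)
    also have "\<dots> = mat_apply (rk (Suc i)) (rk (Suc (Suc i))) (D (Suc i)) ` free_mod ?V (rk (Suc (Suc i)))"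
      unfolding G_syz apply_D by simp
    finally show "{v \<in> free_mod ?V (rk (Suc i)). mat_apply (rk i) (rk (Suc i)) (D i) v = (\<lambda>_. 0)} =
        mat_apply (rk (Suc i)) (rk (Suc (Suc i))) (D (Suc i)) ` free_mod ?V (rk (Suc (Suc i)))" .
  qed
  moreover have "0 < rk 0"
  proof -
    have "u \<in> borel_gens N u" using u by (simp add: borel_gens_def dominating_self)
    then show ?thesis unfolding rk b_def using finite_borel_gens card_gt_0_iff by blast
  qed
  ultimately show ?thesis
    unfolding has_regularity_def
    by (intro exI[of _ rk] exI[of _ "\<lambda>i k. ?d + int i"] exI[of _ "\<lambda>k. monomial (e k)"] exI[of _ D])
       (auto intro: exI[of _ 0])
qed


section \<open>The equivalence\<close>

theorem principal_borel_imp_strong_intersection_type: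
  fixes I :: "'k::field mpoly set"
  assumes "principal_borel n I"
  shows "strong_intersection_type {1..n} I"
proof -
  obtain u where u: "u \<in> mons {1..n}" and I: "I = mon_span (dominating n u)"
    using assms by (auto simp: principal_borel_iff)
  have "has_regularity (loc_vars {1..n} P) (monomial_localization P I) (int (vdeg (loc_vars {1..n} P) u))"
    if "P \<in> ass_primes {1..n} I" for P
  proof -
    obtain i where P: "P = prefix_prime n i" and "i \<in> Poly_Mapping.keys u"
      using \<open>P \<in> ass_primes {1..n} I\<close> unfolding I ass_primes_dominating[OF u] by blast
    then have i: "i \<le> n" using u by (auto simp: mons_def)
    let ?u = "expvec i (Poly_Mapping.lookup u)"
    have "has_regularity {1..i} (mon_span (dominating i ?u) :: 'k mpoly set) (int (vdeg {1..i} ?u))"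
      by (rule has_regularity_dominating[OF expvec_in_mons]) simp
    then show ?thesis
      unfolding P I loc_vars_prefix_prime[OF i] localization_dominating[OF u i]
      by (simp add: vdeg_expvec)
  qed
  then show ?thesis
    unfolding strong_intersection_type_def
    using intersection_type_dominating[OF u I] canonical_primary_decomposition_dominating[OF u I]
    by blast
qed

theorem proposition2p8:
  fixes n :: nat and I :: "'k::field mpoly set"
  assumes "borel_type n I"
    and "I \<noteq> {0}"
  shows "(strong_intersection_type {1..n} I \<longleftrightarrow> intersection_type {1..n} I) \<and>
         (intersection_type {1..n} I \<longleftrightarrow> principal_borel n I)"
proof -
  have "strong_intersection_type {1..n} I \<Longrightarrow> intersection_type {1..n} I"
    by (simp add: strong_intersection_type_def)
  moreover have "intersection_type {1..n} I \<Longrightarrow> principal_borel n I"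
    by (rule borel_type_intersection_type_imp_principal_borel[OF assms])
  moreover have "principal_borel n I \<Longrightarrow> strong_intersection_type {1..n} I"
    by (rule principal_borel_imp_strong_intersection_type)
  ultimately show ?thesis by blast
qed

end
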